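(* Let $u,v$ be two non-constant inner functions and put $\Theta=uv$. Suppose that (i) $\Theta\in\mathfrak I_c$ and $\eta\in\,]0,1[$ is chosen so that $\Omega_\Theta(\eta)$ is connected; (ii) $\sigma:=\sup\{|v(z)|: z\in\mathbb D,\ |\Theta(z)|=\eta\}\in\,]\eta,1[$ (or, equivalently, $\delta:=\inf\{|u(z)|: z\in\mathbb D,\ |\Theta(z)|=\eta\}\in\,]\eta,1[$). Then $v\in\mathfrak I_c$. The assertion does not necessarily hold if $\sigma=1$ (or, equivalently, if $\delta=\eta$); that is, there exist non-constant inner functions $u,v$ and $\eta\in\,]0,1[$ such that $\Theta=uv\in\mathfrak I_c$, $\Omega_\Theta(\eta)$ is connected, $\sup\{|v(z)|: z\in\mathbb D,\ |\Theta(z)|=\eta\}=1$, and $v\notin\mathfrak I_c$.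
   Context: $\mathbb D$ is the open unit disk in $\mathbb C$, and $H^\infty$ is the algebra of bounded holomorphic functions on $\mathbb D$. An inner function is a function $u\in H^\infty$ whose radial limits have modulus $1$ almost everywhere on the unit circle $\mathbb T$. For an inner function $u$ and $\eta\in\,]0,1[$ put $\Omega_u(\eta):=\{z\in\mathbb D: |u(z)|<\eta\}$. An inner function $u$ is called a one-component inner function if there is $\eta\in\,]0,1[$ such that $\Omega_u(\eta)$ is connected; unimodular constants are considered to be one-component inner functions. $\mathfrak I_c$ denotes the set of all one-component inner functions. *)

theory Defs
  imports "HOL-Complex_Analysis.Complex_Analysis"
begin

text \<open>
  Functions on the open unit disk are rendered as total functions \<^typ>\<open>complex \<Rightarrow> complex\<close>; their
  values outside \<^term>\<open>ball 0 1 :: complex set\<close> are irrelevant to every notion below.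
\<close>

definition H_infinity :: "(complex \<Rightarrow> complex) set" where
  "H_infinity = {f. f holomorphic_on ball 0 1 \<and> bounded (f ` ball 0 1)}"

text \<open>
  The unit circle is parametrised by \<^term>\<open>cis t\<close> with \<open>t\<close> in \<open>[0, 2\<pi>]\<close>, so arc length
  on the circle corresponds to Lebesgue measure on that interval.
\<close>

definition inner_function :: "(complex \<Rightarrow> complex) \<Rightarrow> bool" where
  "inner_function u \<longleftrightarrow>
     u \<in> H_infinity \<and>
     (AE t in lebesgue_on {0..2 * pi}.
        \<exists>L. ((\<lambda>r. u (complex_of_real r * cis t)) \<longlongrightarrow> L) (at_left 1) \<and> cmod L = 1)"

definition Omega :: "(complex \<Rightarrow> complex) \<Rightarrow> real \<Rightarrow> complex set" where
  "Omega u \<eta> = {z \<in> ball 0 1. cmod (u z) < \<eta>}"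

definition level_set :: "(complex \<Rightarrow> complex) \<Rightarrow> real \<Rightarrow> complex set" where
  "level_set u \<eta> = {z \<in> ball 0 1. cmod (u z) = \<eta>}"

text \<open>
  A constant inner function is automatically unimodular.
\<close>

definition one_component_inner :: "(complex \<Rightarrow> complex) set" where
  "one_component_inner =
     {u. inner_function u \<and>
         (u constant_on ball 0 1 \<or> (\<exists>\<eta>\<in>{0<..<1}. connected (Omega u \<eta>)))}"

end

theory Submission
  imports Defs
begin

text \<open>
  The main tool is a maximum principle on open subsets \<open>U\<close> of the disk that almost every radius
  eventually leaves: if \<open>\<bar>f\<bar> \<le> c\<close> on the part of the boundary of \<open>U\<close> inside the disk and \<open>f\<close> is bounded
  and holomorphic on \<open>U\<close>, then \<open>\<bar>f\<bar> \<le> c\<close> on \<open>U\<close>. Indeed, \<open>max \<bar>f\<bar> c\<close> extended by \<open>c\<close> is subharmonic on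
  the disk, and its means over circles increase with the radius and tend to \<open>c\<close> by dominated convergence.
  Applied to \<open>v\<close> on \<open>\<Omega>\<^sub>\<Theta>(\<eta>)\<close> it gives \<open>\<Omega>\<^sub>\<Theta>(\<eta>) \<subseteq> \<Omega>\<^sub>v(s)\<close> for \<open>\<sigma> < s < 1\<close>; applied to \<open>1 / v\<close> on a component
  of \<open>\<Omega>\<^sub>v(s)\<close> missing \<open>\<Omega>\<^sub>\<Theta>(\<eta>)\<close>, where \<open>\<bar>v\<bar> \<ge> \<bar>\<Theta>\<bar> \<ge> \<eta>\<close>, it gives a contradiction.

  For the counterexample, pass to the right half-plane by \<open>w = (1 + z) / (1 - z)\<close> and take
  \<open>u = exp (- w)\<close> and the Blaschke product \<open>v\<close> with zeros \<open>w = 4 ^ k\<^sup>2\<close>. These zeros are so sparse that \<open>\<bar>v\<bar>\<close>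
  is close to \<open>1\<close> on semicircles separating consecutive zeros, so no \<open>\<Omega>\<^sub>v(s)\<close> is connected. But \<open>\<bar>v\<bar>\<close>
  is bounded below outside the horodisk \<open>Re w > 1 / 16\<close>, so every component of \<open>\<Omega>\<^sub>\<Theta>(exp (- 1 / 16))\<close> meets
  that horodisk. That \<open>\<sigma> = 1\<close> then follows from the positive part.
\<close>

subsection \<open>A maximum principle with radial boundary conditions\<close>

text \<open>The shifted interval \<open>[\<theta>, 2 * pi + \<theta>]\<close> is cut at
  \<open>2 * pi\<close>, and its tail moves back by one period to
  \<open>[0, \<theta>]\<close>.\<close>

lemma integral_periodic_shift:
  fixes F :: "real \<Rightarrow> real"
  assumes cont: "continuous_on UNIV F" and per: "\<And>t. F (t + 2 * pi) = F t"
    and "0 \<le> \<theta>" "\<theta> \<le> 2 * pi"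
  shows "integral {0..2 * pi} (\<lambda>t. F (\<theta> + t)) = integral {0..2 * pi} F"
proof -
  have int: "F integrable_on {a..b}" for a b
    by (intro integrable_continuous_real continuous_on_subset[OF cont]) auto
  have "integral {0..2 * pi} (\<lambda>t. F (\<theta> + t)) = integral {\<theta>..2 * pi + \<theta>} F"
    using integral_shift_Icc_real[of 0 "2 * pi" F \<theta>] by (simp add: o_def add.commute)
  also have "\<dots> = integral {\<theta>..2 * pi} F + integral {2 * pi..2 * pi + \<theta>} F"
    using assms int by (simp add: Henstock_Kurzweil_Integration.integral_combine)
  also have "integral {2 * pi..2 * pi + \<theta>} F = integral {0..\<theta>} (\<lambda>t. F (2 * pi + t))"
    using integral_shift_Icc_real[of 0 \<theta> F "2 * pi"] by (simp add: o_def add.commute)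
  also have "\<dots> = integral {0..\<theta>} F"
    using per by (simp add: add.commute)
  also have "integral {\<theta>..2 * pi} F + integral {0..\<theta>} F = integral {0..2 * pi} F"
    using Henstock_Kurzweil_Integration.integral_combine[of 0 \<theta> "2 * pi" F] assms int by simp
  finally show ?thesis .
qed

text \<open>Absolute values in Cauchy's integral formula at the center. Beyond continuity, this is
  all that the maximum principle takes from holomorphy.\<close>

lemma cmod_le_circle_integral:
  assumes "f holomorphic_on ball z R" "0 < \<rho>" "\<rho> < R"
  shows "2 * pi * cmod (f z) \<le> integral {0..2 * pi} (\<lambda>t. cmod (f (z + of_real \<rho> * cis t)))"
proof -
  have holo: "f holomorphic_on ball z \<rho>" and cont: "continuous_on (cball z \<rho>) f"
    using assms by (auto intro!: holomorphic_on_imp_continuous_on holomorphic_on_subset[OF assms(1)])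
  have "((\<lambda>u. f u / (u - z)) has_contour_integral (2 * of_real pi * \<i> * f z)) (circlepath z \<rho>)"
    using Cauchy_integral_circlepath[OF cont holo, of z] assms by simp
  then have "((\<lambda>t. f (z + of_real \<rho> * cis t) / (of_real \<rho> * cis t) * of_real \<rho> * \<i> * cis t)
      has_integral (2 * of_real pi * \<i> * f z)) {0..2 * pi}"
    unfolding circlepath_def by (subst (asm) has_contour_integral_part_circlepath_iff) auto
  moreover have "(\<lambda>t. f (z + of_real \<rho> * cis t) / (of_real \<rho> * cis t) * of_real \<rho> * \<i> * cis t)
      = (\<lambda>t. f (z + of_real \<rho> * cis t) * \<i>)"
    using assms by (auto simp: field_simps)
  ultimately have hi: "((\<lambda>t. f (z + of_real \<rho> * cis t) * \<i>) has_integral (2 * of_real pi * \<i> * f z)) {0..2 * pi}"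
    by simp
  have *: "continuous_on {0..2 * pi} (\<lambda>t. f (z + of_real \<rho> * cis t))"
    by (rule continuous_on_compose2[OF cont])
      (use assms in \<open>auto intro!: continuous_intros simp: dist_norm norm_mult\<close>)
  have "norm (integral {0..2 * pi} (\<lambda>t. f (z + of_real \<rho> * cis t) * \<i>))
      \<le> integral {0..2 * pi} (\<lambda>t. cmod (f (z + of_real \<rho> * cis t)))"
    using hi * by (intro Henstock_Kurzweil_Integration.integral_norm_bound_integral integrable_continuous_real continuous_intros)
      (auto simp: norm_mult)
  then show ?thesis
    using integral_unique[OF hi] by (simp add: norm_mult)
qed

text \<open>\<open>2 * pi\<close> times the mean over the circle about 0 through \<open>z\<close>.
  With a complex starting point it is the integral of \<open>h\<close> over all rotations, again a
  function on the disk, which turns out to be radial.\<close>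

definition circle_integral :: "(complex \<Rightarrow> real) \<Rightarrow> complex \<Rightarrow> real" where
  "circle_integral h z = integral {0..2 * pi} (\<lambda>t. h (z * cis t))"

lemma continuous_on_circle_integral:
  assumes "continuous_on (ball 0 1) h"
  shows "continuous_on (ball 0 1) (circle_integral h)"
proof -
  have "continuous_on (ball 0 1 \<times> cbox 0 (2 * pi)) (\<lambda>(z, t). h (z * cis t))"
    unfolding split_def
    by (rule continuous_on_compose2[OF assms]) (auto intro!: continuous_intros simp: norm_mult)
  from integral_continuous_on_param[OF this] show ?thesis
    by (simp add: circle_integral_def[abs_def])
qed

lemma circle_integral_rotate:
  assumes "continuous_on (ball 0 1) h" "cmod z < 1" "0 \<le> \<theta>" "\<theta> \<le> 2 * pi"
  shows "circle_integral h (z * cis \<theta>) = circle_integral h z"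
proof -
  have "continuous_on UNIV (\<lambda>t. h (z * cis t))"
    by (rule continuous_on_compose2[OF assms(1)]) (use assms in \<open>auto intro!: continuous_intros simp: norm_mult\<close>)
  moreover have "cis (t + 2 * pi) = cis t" for t
    by (simp add: complex_eq_iff)
  ultimately show ?thesis
    unfolding circle_integral_def
    using integral_periodic_shift[of "\<lambda>t. h (z * cis t)" \<theta>] assms by (simp add: cis_mult mult.assoc)
qed

lemma circle_integral_cmod:
  assumes "continuous_on (ball 0 1) h" "cmod z < 1"
  shows "circle_integral h z = circle_integral h (of_real (cmod z))"
proof -
  have "z = of_real (cmod z) * cis (Arg2pi z)"
    using Arg2pi_eq[of z] by (simp add: cis_conv_exp)
  with circle_integral_rotate[OF assms(1), of "of_real (cmod z)" "Arg2pi z"] assms Arg2pi[of z]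
  show ?thesis by simp
qed

text \<open>
  Averaging over rotations turns the submean inequality for \<open>h\<close> into one for a radial function
  (Fubini), which therefore attains its maximum over a closed disk on the boundary circle.
\<close>

lemma circle_integral_mono:
  assumes cont: "continuous_on (ball 0 1) h"
    and sub: "\<And>s. s < 1 \<Longrightarrow> \<exists>d>0. \<forall>z\<in>cball 0 s. \<forall>\<rho>. 0 < \<rho> \<and> \<rho> < d \<longrightarrow>
        2 * pi * h z \<le> integral {0..2 * pi} (\<lambda>t. h (z + of_real \<rho> * cis t))"
    and "0 \<le> r" "r \<le> s" "s < 1"
  shows "circle_integral h (of_real r) \<le> circle_integral h (of_real s)"
proof (rule ccontr)
  define \<Phi> where "\<Phi> = (\<lambda>r. circle_integral h (of_real r))"
  assume "\<not> ?thesis"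
  then have neg: "\<Phi> s < \<Phi> r" by (simp add: \<Phi>_def)
  have cont\<Phi>: "continuous_on {0..s} \<Phi>"
    unfolding \<Phi>_def
    by (rule continuous_on_compose2[OF continuous_on_circle_integral[OF cont]])
      (use assms in \<open>auto intro!: continuous_intros\<close>)
  obtain m where m: "m \<in> {0..s}" "\<And>x. x \<in> {0..s} \<Longrightarrow> \<Phi> x \<le> \<Phi> m"
    using continuous_attains_sup[OF _ _ cont\<Phi>] assms by auto
  \<comment> \<open>Among the maximum points of \<Phi> on \<open>[0, s]\<close> the largest,
    \<open>p\<close>, is taken. It differs from \<open>s\<close> because \<Phi> is larger at
    \<open>r\<close>.\<close>
  define A where "A = {x \<in> {0..s}. \<Phi> x \<ge> \<Phi> m}"
  have "closed A"
    unfolding A_def using continuous_closed_preimage[OF cont\<Phi>, of "{\<Phi> m..}"]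
    by (simp add: vimage_def Int_def)
  moreover have "bounded A" unfolding A_def by (rule bounded_subset[of "{0..s}"]) auto
  ultimately have "compact A" by (simp add: compact_eq_bounded_closed)
  moreover have "m \<in> A" using m by (auto simp: A_def)
  ultimately obtain p where p: "p \<in> A" "\<And>x. x \<in> A \<Longrightarrow> x \<le> p"
    using compact_attains_sup[of A] by auto
  have p_max: "\<Phi> x \<le> \<Phi> p" if "x \<in> {0..s}" for x
    using m(2)[OF that] p(1) by (simp add: A_def)
  have p0: "0 \<le> p" "p \<le> s" using p(1) by (auto simp: A_def)
  moreover have "p \<noteq> s" using neg p_max[of r] assms by auto
  ultimately have ps: "p < s" by simp
  obtain d where d: "d > 0" "\<And>z \<rho>. cmod z \<le> s \<Longrightarrow> 0 < \<rho> \<Longrightarrow> \<rho> < d \<Longrightarrow>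
        2 * pi * h z \<le> integral {0..2 * pi} (\<lambda>t. h (z + of_real \<rho> * cis t))"
    using sub[OF \<open>s < 1\<close>] by auto
  \<comment> \<open>With \<open>\<rho> \<le> s - p\<close> the circle about \<open>p\<close> stays
    in the closed disk of radius \<open>s\<close>, so \<Phi> is at most \<open>\<Phi> p\<close>
    along it.\<close>
  define \<rho> where "\<rho> = min (d / 2) (s - p)"
  have \<rho>: "0 < \<rho>" "\<rho> < d" "p + \<rho> \<le> s" using d(1) ps by (auto simp: \<rho>_def)
  define q where "q = (\<lambda>\<theta>. of_real p + of_real \<rho> * cis \<theta>)"
  have q: "cmod (q \<theta>) \<le> s" for \<theta>
  proof -
    have "cmod (q \<theta>) \<le> p + \<rho>"
      unfolding q_def by (rule norm_triangle_le) (use \<rho> p0 in \<open>auto simp: norm_mult\<close>)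
    with \<rho> show ?thesis by simp
  qed
  have q1: "cmod (q \<theta>) < 1" for \<theta>
    using q[of \<theta>] \<open>s < 1\<close> by simp
  have contq: "continuous_on X q" for X unfolding q_def by (intro continuous_intros)
  \<comment> \<open>The submean inequality at the rotated center \<open>of_real p * cis t\<close>.
    By periodicity its circle may be parametrised as the rotation of \<open>q\<close> by
    \<open>t\<close>.\<close>
  have submean: "2 * pi * h (of_real p * cis t) \<le> integral {0..2 * pi} (\<lambda>\<theta>. h (q \<theta> * cis t))"
    if t: "t \<in> {0..2 * pi}" for t
  proof -
    define F where "F = (\<lambda>\<theta>. h (of_real p * cis t + of_real \<rho> * cis \<theta>))"
    have "continuous_on UNIV F"
      unfolding F_def
    proof (rule continuous_on_compose2[OF cont])
      have "cmod (of_real p * cis t + of_real \<rho> * cis \<theta>) < 1" for \<theta>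
        by (rule norm_triangle_lt) (use \<rho> p0 \<open>s < 1\<close> in \<open>auto simp: norm_mult\<close>)
      then show "range (\<lambda>\<theta>. of_real p * cis t + of_real \<rho> * cis \<theta>) \<subseteq> ball 0 1"
        by auto
    qed (intro continuous_intros)
    moreover have "F (\<theta> + 2 * pi) = F \<theta>" for \<theta>
      unfolding F_def by (simp add: complex_eq_iff cis.ctr)
    ultimately have "integral {0..2 * pi} (\<lambda>\<theta>. F (t + \<theta>)) = integral {0..2 * pi} F"
      using integral_periodic_shift t by simp
    moreover have "F (t + \<theta>) = h (q \<theta> * cis t)" for \<theta>
      by (simp add: F_def q_def cis_mult[symmetric] algebra_simps)
    moreover have "2 * pi * h (of_real p * cis t) \<le> integral {0..2 * pi} F"
      unfolding F_def by (rule d(2)) (use \<rho> ps p0 in \<open>auto simp: norm_mult\<close>)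
    ultimately show ?thesis by simp
  qed
  have cont2: "continuous_on (cbox (0, 0) (2 * pi, 2 * pi)) (\<lambda>(t, \<theta>). h (q \<theta> * cis t))"
    unfolding split_def
    by (rule continuous_on_compose2[OF cont])
      (use q1 in \<open>auto intro!: continuous_intros continuous_on_compose2[OF contq] simp: norm_mult\<close>)
  have cont3: "continuous_on {0..2 * pi} (\<lambda>t. integral {0..2 * pi} (\<lambda>\<theta>. h (q \<theta> * cis t)))"
    using integral_continuous_on_param[of "{0..2 * pi}" 0 "2 * pi" "\<lambda>t \<theta>. h (q \<theta> * cis t)"] cont2
    by (simp add: cbox_Pair_eq)
  have contp: "continuous_on {0..2 * pi} (\<lambda>t. h (of_real p * cis t))"
    by (rule continuous_on_compose2[OF cont]) (use ps p0 assms in \<open>auto intro!: continuous_intros simp: norm_mult\<close>)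
  have "2 * pi * \<Phi> p = integral {0..2 * pi} (\<lambda>t. 2 * pi * h (of_real p * cis t))"
    by (simp add: \<Phi>_def circle_integral_def)
  also have "\<dots> \<le> integral {0..2 * pi} (\<lambda>t. integral {0..2 * pi} (\<lambda>\<theta>. h (q \<theta> * cis t)))"
    by (intro integral_le integrable_continuous_real cont3 continuous_intros contp submean)
  \<comment> \<open>Exchanging the integrals carries out the average over rotations first, which
    leaves the radial function \<Phi>.\<close>
  also have "\<dots> = integral {0..2 * pi} (\<lambda>\<theta>. circle_integral h (q \<theta>))"
    unfolding circle_integral_def using integral_swap_continuous[OF cont2] by simp
  also have "\<dots> = integral {0..2 * pi} (\<lambda>\<theta>. \<Phi> (cmod (q \<theta>)))"
    unfolding \<Phi>_def using q1 by (intro Henstock_Kurzweil_Integration.integral_cong circle_integral_cmod[OF cont]) auto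
  finally have le: "2 * pi * \<Phi> p \<le> integral {0..2 * pi} (\<lambda>\<theta>. \<Phi> (cmod (q \<theta>)))" .
  have contN: "continuous_on {0..2 * pi} (\<lambda>\<theta>. \<Phi> (cmod (q \<theta>)))"
    by (rule continuous_on_compose2[OF cont\<Phi>]) (use q in \<open>auto intro!: continuous_intros contq\<close>)
  have "integral {0..2 * pi} (\<lambda>\<theta>. \<Phi> p - \<Phi> (cmod (q \<theta>))) = 2 * pi * \<Phi> p - integral {0..2 * pi} (\<lambda>\<theta>. \<Phi> (cmod (q \<theta>)))"
    by (subst Henstock_Kurzweil_Integration.integral_diff) (auto intro!: integrable_continuous_real contN)
  moreover have "integral {0..2 * pi} (\<lambda>\<theta>. \<Phi> p - \<Phi> (cmod (q \<theta>))) \<ge> 0"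
    using p_max q by (intro Henstock_Kurzweil_Integration.integral_nonneg integrable_continuous_real continuous_intros contN) auto
  ultimately have "integral {0..2 * pi} (\<lambda>\<theta>. \<Phi> p - \<Phi> (cmod (q \<theta>))) = 0"
    using le by linarith
  \<comment> \<open>A nonnegative continuous integrand with integral 0 vanishes everywhere, in
    particular at angle 0, where the modulus of \<open>q\<close> is \<open>p + \<rho>\<close>. This
    is a maximum point beyond \<open>p\<close>.\<close>
  then have "\<Phi> p - \<Phi> (cmod (q 0)) = 0"
    using p_max q by (subst (asm) integral_eq_0_iff) (auto intro!: continuous_intros contN)
  moreover have "cmod (q 0) = p + \<rho>"
  proof -
    have "q 0 = of_real (p + \<rho>)" by (simp add: q_def)
    then show ?thesis using p0 \<rho>(1) by (simp only: norm_of_real)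
  qed
  ultimately have "p + \<rho> \<in> A" using p(1) \<rho> p0 by (auto simp: A_def)
  with p(2)[of "p + \<rho>"] \<rho>(1) show False by simp
qed

lemma radial_maximum_principle:
  assumes "open U" "U \<subseteq> ball 0 1" and holo: "f holomorphic_on U"
    and contf: "continuous_on (ball 0 1 \<inter> closure U) f"
    and bdry: "\<And>z. z \<in> ball 0 1 \<inter> frontier U \<Longrightarrow> cmod (f z) \<le> c"
    and bdd: "bounded (f ` U)"
    and ae: "AE t in lebesgue_on {0..2 * pi}. \<forall>\<^sub>F r in at_left 1. complex_of_real r * cis t \<notin> U"
    and "z \<in> U"
  shows "cmod (f z) \<le> c"
proof (rule field_le_epsilon)
  fix e :: real assume "0 < e"
  \<comment> \<open>Truncating at \<open>c + e\<close> instead of \<open>c\<close> makes the radius in the submean inequality uniform on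
    compact disks: where \<open>g\<close> exceeds \<open>c + e\<close>, a ball of uniform radius stays inside \<open>U\<close>.\<close>
  define g where "g = (\<lambda>z. if z \<in> U then max (cmod (f z)) c else c)"
  define h where "h = (\<lambda>z. max (g z) (c + e))"
  have ball_eq: "ball 0 1 = (ball 0 1 \<inter> closure U) \<union> (ball 0 1 - U)"
    using closure_subset[of U] by auto
  \<comment> \<open>Pasting along two relatively closed sets: they meet only in boundary points of
    \<open>U\<close> inside the disk, where \<open>bdry\<close> makes both formulas equal to
    \<open>c\<close>.\<close>
  have contg: "continuous_on (ball 0 1) g"
    unfolding g_def
  proof (subst ball_eq, rule continuous_on_cases_local)
    show "closedin (top_of_set (ball 0 1 \<inter> closure U \<union> (ball 0 1 - U))) (ball 0 1 \<inter> closure U)"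
      unfolding ball_eq[symmetric] by (simp add: closedin_closed_Int)
    show "closedin (top_of_set (ball 0 1 \<inter> closure U \<union> (ball 0 1 - U))) (ball 0 1 - U)"
      unfolding ball_eq[symmetric] using \<open>open U\<close>
      by (simp add: Diff_eq closedin_closed_Int open_closed)
    show "max (cmod (f x)) c = c" if "x \<in> ball 0 1 \<inter> closure U \<and> x \<notin> U \<or> x \<in> ball 0 1 - U \<and> x \<in> U" for x
      using that bdry[of x] \<open>open U\<close> by (auto simp: frontier_def interior_open)
  qed (intro continuous_intros contf)+
  then have conth: "continuous_on (ball 0 1) h"
    unfolding h_def by (intro continuous_intros)
  obtain b where b: "\<And>z. z \<in> U \<Longrightarrow> cmod (f z) \<le> b"
    using bdd by (auto simp: bounded_iff)
  have h_bound: "\<bar>h z\<bar> \<le> \<bar>b\<bar> + \<bar>c\<bar> + e" for z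
    using b[of z] \<open>0 < e\<close> unfolding h_def g_def by auto
  have h_ge: "c + e \<le> h z" for z unfolding h_def by simp
  have sub: "\<exists>d>0. \<forall>z\<in>cball 0 s. \<forall>\<rho>. 0 < \<rho> \<and> \<rho> < d \<longrightarrow>
        2 * pi * h z \<le> integral {0..2 * pi} (\<lambda>t. h (z + of_real \<rho> * cis t))" if "s < 1" for s
  proof -
    \<comment> \<open>The larger radius leaves room for circles about points of the disk of radius
      \<open>s\<close>, inside a compact disk on which \<open>g\<close> is uniformly
      continuous.\<close>
    define s1 where "s1 = (1 + s) / 2"
    have s1: "s < s1" "s1 < 1" using that by (auto simp: s1_def)
    have "continuous_on (cball 0 s1) g"
      by (rule continuous_on_subset[OF contg]) (use s1 in auto)
    then have "uniformly_continuous_on (cball 0 s1) g"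
      by (simp add: compact_uniformly_continuous)
    then obtain d0 where d0: "d0 > 0" "\<And>x y. x \<in> cball 0 s1 \<Longrightarrow> y \<in> cball 0 s1 \<Longrightarrow> dist y x < d0 \<Longrightarrow> dist (g y) (g x) < e"
      using \<open>0 < e\<close> unfolding uniformly_continuous_on_def by metis
    define d where "d = min d0 (s1 - s)"
    have "2 * pi * h z \<le> integral {0..2 * pi} (\<lambda>t. h (z + of_real \<rho> * cis t))"
      if z: "cmod z \<le> s" and \<rho>: "0 < \<rho>" "\<rho> < d" for z \<rho>
    proof -
      have near: "w \<in> cball 0 s1" if "w \<in> ball z d" for w
      proof -
        have "cmod w \<le> cmod z + dist z w"
          by (simp add: dist_norm norm_triangle_sub norm_minus_commute)
        then show ?thesis using that z by (simp add: d_def)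
      qed
      have inb: "z + of_real \<rho> * cis t \<in> ball z d" for t
        using \<rho> by (simp add: dist_norm norm_mult)
      have in1: "z + of_real \<rho> * cis t \<in> ball 0 1" for t
        using near[OF inb[of t]] s1 by simp
      have hc: "continuous_on {0..2 * pi} (\<lambda>t. h (z + of_real \<rho> * cis t))"
        by (rule continuous_on_compose2[OF conth]) (use in1 in \<open>auto intro!: continuous_intros\<close>)
      show ?thesis
      proof (cases "g z \<le> c + e")
        \<comment> \<open>Here \<open>h z\<close> is the least value \<open>c + e\<close> of
          \<open>h\<close>, so every mean of \<open>h\<close> dominates it.\<close>
        case True
        then have "2 * pi * h z = integral {0..2 * pi} (\<lambda>t. c + e)"
          by (simp add: h_def max_def)
        also have "\<dots> \<le> integral {0..2 * pi} (\<lambda>t. h (z + of_real \<rho> * cis t))"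
          by (intro integral_le integrable_continuous_real hc h_ge) auto
        finally show ?thesis .
      next
        case False
        have inU: "w \<in> U" if "w \<in> ball z d" for w
        proof (rule ccontr)
          assume "w \<notin> U"
          then have "g w = c" by (simp add: g_def)
          moreover have "dist (g w) (g z) < e"
            by (rule d0(2)) (use near that z s1 in \<open>auto simp: d_def dist_commute\<close>)
          ultimately show False using False by (simp add: dist_real_def)
        qed
        have "0 < d" using \<rho> by simp
        then have "z \<in> U" using inU[of z] by simp
        with False have "h z = cmod (f z)" using \<open>0 < e\<close> by (auto simp: h_def g_def max_def split: if_splits)
        moreover have "f holomorphic_on ball z d"
          by (rule holomorphic_on_subset[OF holo]) (use inU in blast)
        ultimately have "2 * pi * h z \<le> integral {0..2 * pi} (\<lambda>t. cmod (f (z + of_real \<rho> * cis t)))"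
          using cmod_le_circle_integral[of f z d \<rho>] \<rho> by simp
        also have "\<dots> \<le> integral {0..2 * pi} (\<lambda>t. h (z + of_real \<rho> * cis t))"
        proof (intro integral_le integrable_continuous_real hc)
          show "continuous_on {0..2 * pi} (\<lambda>t. cmod (f (z + of_real \<rho> * cis t)))"
            by (intro continuous_on_norm continuous_on_compose2[OF holomorphic_on_imp_continuous_on[OF holo]] continuous_intros)
              (use inU inb in auto)
          show "cmod (f (z + of_real \<rho> * cis t)) \<le> h (z + of_real \<rho> * cis t)" for t
            using inU[OF inb[of t]] by (simp add: h_def g_def)
        qed
        finally show ?thesis .
      qed
    qed
    moreover have "0 < d" using d0 s1 by (simp add: d_def)
    ultimately show ?thesis by auto
  qed
  define r where "r = (\<lambda>n. 1 - inverse (real (Suc n)))"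
  have r: "0 \<le> r n" "r n < 1" for n by (auto simp: r_def field_simps)
  have r_lim: "r \<longlonglongrightarrow> 1"
    unfolding r_def by (rule tendsto_eq_intros LIMSEQ_inverse_real_of_nat refl)+ simp
  then have r_left: "filterlim r (at_left 1) sequentially"
    using less_imp_neq[OF r(2)] r(2) by (auto simp: filterlim_at simp del: of_nat_Suc intro!: always_eventually)
  have conthr: "continuous_on {0..2 * pi} (\<lambda>t. h (w * cis t))" if "cmod w < 1" for w
    by (rule continuous_on_compose2[OF conth]) (use that in \<open>auto intro!: continuous_intros simp: norm_mult\<close>)
  have "(\<lambda>n. integral\<^sup>L (lebesgue_on {0..2 * pi}) (\<lambda>t. h (of_real (r n) * cis t)))
      \<longlonglongrightarrow> integral\<^sup>L (lebesgue_on {0..2 * pi}) (\<lambda>t. c + e)"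
  proof (rule integral_dominated_convergence[where w="\<lambda>t. \<bar>b\<bar> + \<bar>c\<bar> + e"])
    show "(\<lambda>t. h (of_real (r n) * cis t)) \<in> borel_measurable (lebesgue_on {0..2 * pi})" for n
      using r by (intro continuous_imp_measurable_on_sets_lebesgue conthr) auto
    \<comment> \<open>Almost every radius is eventually outside \<open>U\<close>, where
      \<open>h\<close> is constantly \<open>c + e\<close>.\<close>
    show "AE t in lebesgue_on {0..2 * pi}. (\<lambda>n. h (of_real (r n) * cis t)) \<longlonglongrightarrow> c + e"
      using ae
    proof eventually_elim
      case (elim t)
      from filterlim_iff[THEN iffD1, OF r_left, rule_format, OF this]
      have "\<forall>\<^sub>F n in sequentially. complex_of_real (r n) * cis t \<notin> U" .
      then have "\<forall>\<^sub>F n in sequentially. h (complex_of_real (r n) * cis t) = c + e"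
        by eventually_elim (use \<open>0 < e\<close> in \<open>simp add: h_def g_def\<close>)
      then show ?case by (rule tendsto_eventually)
    qed
  qed (use h_bound in auto)
  then have lim: "(\<lambda>n. circle_integral h (of_real (r n))) \<longlonglongrightarrow> 2 * pi * (c + e)"
    using r conthr
    by (simp add: circle_integral_def lebesgue_integral_eq_integral continuous_imp_integrable_real measure_restrict_space)
  have z1: "cmod z < 1" using \<open>z \<in> U\<close> \<open>U \<subseteq> ball 0 1\<close> by auto
  \<comment> \<open>The means increase with the radius, so each of them is at most their
    limit.\<close>
  have "circle_integral h z \<le> 2 * pi * (c + e)"
  proof (rule tendsto_lowerbound[OF lim])
    have "\<forall>\<^sub>F n in sequentially. cmod z < r n"
      using order_tendstoD(1)[OF r_lim z1] .
    then show "\<forall>\<^sub>F n in sequentially. circle_integral h z \<le> circle_integral h (of_real (r n))"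
    proof eventually_elim
      case (elim n)
      then show ?case
        using circle_integral_mono[OF conth sub, of "cmod z" "r n"] r circle_integral_cmod[OF conth z1] by simp
    qed
  qed simp
  \<comment> \<open>From mean to point: \<open>h\<close> is nowhere below \<open>c + e\<close>, so a
    mean of at most \<open>c + e\<close> forces equality on the whole circle through
    \<open>z\<close>. Angle 0 is \<open>z\<close> itself.\<close>
  moreover have "integral {0..2 * pi} (\<lambda>t. h (z * cis t) - (c + e)) = circle_integral h z - 2 * pi * (c + e)"
    unfolding circle_integral_def
    by (subst Henstock_Kurzweil_Integration.integral_diff) (use conthr z1 in \<open>auto intro!: integrable_continuous_real\<close>)
  moreover have "integral {0..2 * pi} (\<lambda>t. h (z * cis t) - (c + e)) \<ge> 0"
    using h_ge z1 by (intro Henstock_Kurzweil_Integration.integral_nonneg integrable_continuous_real continuous_intros conthr) auto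
  ultimately have "integral {0..2 * pi} (\<lambda>t. h (z * cis t) - (c + e)) = 0" by linarith
  then have "\<forall>t\<in>{0..2 * pi}. h (z * cis t) - (c + e) = 0"
    using h_ge z1 by (subst (asm) integral_eq_0_iff) (auto intro!: continuous_intros conthr)
  then have "h z - (c + e) = 0" by (auto dest: bspec[of _ _ 0])
  then show "cmod (f z) \<le> c + e"
    using \<open>z \<in> U\<close> by (simp add: h_def g_def)
qed

subsection \<open>Inner functions and their sublevel sets\<close>

lemma inner_function_holomorphic: "inner_function u \<Longrightarrow> u holomorphic_on ball 0 1"
  by (simp add: inner_function_def H_infinity_def)

lemma inner_function_continuous: "inner_function u \<Longrightarrow> continuous_on (ball 0 1) u"
  by (intro holomorphic_on_imp_continuous_on inner_function_holomorphic)

lemma inner_function_bounded: "inner_function u \<Longrightarrow> bounded (u ` ball 0 1)"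
  by (simp add: inner_function_def H_infinity_def)

lemma inner_function_AE_tendsto:
  assumes "inner_function u"
  shows "AE t in lebesgue_on {0..2 * pi}. ((\<lambda>r. cmod (u (complex_of_real r * cis t))) \<longlongrightarrow> 1) (at_left 1)"
proof -
  have "AE t in lebesgue_on {0..2 * pi}. \<exists>L. ((\<lambda>r. u (complex_of_real r * cis t)) \<longlongrightarrow> L) (at_left 1) \<and> cmod L = 1"
    using assms by (simp add: inner_function_def)
  then show ?thesis
    by eventually_elim (auto dest: tendsto_norm)
qed

lemma inner_function_AE_less:
  assumes "inner_function u" "s < 1"
  shows "AE t in lebesgue_on {0..2 * pi}. \<forall>\<^sub>F r in at_left 1. s < cmod (u (complex_of_real r * cis t))"
  using inner_function_AE_tendsto[OF assms(1)]
  by eventually_elim (rule order_tendstoD(1)[OF _ assms(2)])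

text \<open>Supplies the radial condition of \<open>radial_maximum_principle\<close> for sets on
  which the modulus stays at most \<open>s < 1\<close>.\<close>

lemma inner_function_AE_notin:
  assumes "inner_function u" "s < 1" "\<And>z. z \<in> U \<Longrightarrow> cmod (u z) \<le> s"
  shows "AE t in lebesgue_on {0..2 * pi}. \<forall>\<^sub>F r in at_left 1. complex_of_real r * cis t \<notin> U"
  using inner_function_AE_less[OF assms(1,2)]
proof eventually_elim
  case (elim t)
  then show ?case by eventually_elim (use assms(3) in fastforce)
qed

text \<open>The definition only gives some bound, so the bound 1 must come from the radial limits.
  The maximum principle applies to the set where the modulus exceeds a number \<open>c > 1\<close>,
  since almost every radius leaves it.\<close>

lemma inner_function_le_1:
  assumes "inner_function u" "cmod z < 1"
  shows "cmod (u z) \<le> 1"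
proof (rule ccontr)
  assume neg: "\<not> cmod (u z) \<le> 1"
  define c where "c = (1 + cmod (u z)) / 2"
  have c: "1 < c" "c < cmod (u z)" using neg by (auto simp: c_def)
  define U where "U = {z \<in> ball 0 1. c < cmod (u z)}"
  have "open (ball 0 1 \<inter> (\<lambda>z. cmod (u z)) -` {c<..})"
    by (intro continuous_open_preimage continuous_on_norm open_ball open_greaterThan
        inner_function_continuous assms)
  moreover have "ball 0 1 \<inter> (\<lambda>z. cmod (u z)) -` {c<..} = U" by (auto simp: U_def)
  ultimately have "open U" by simp
  have "cmod (u z) \<le> c"
  proof (rule radial_maximum_principle[OF \<open>open U\<close>, where f=u and z=z])
    show "U \<subseteq> ball 0 1" by (auto simp: U_def)
    show "u holomorphic_on U"
      by (rule holomorphic_on_subset[OF inner_function_holomorphic[OF assms(1)]]) (auto simp: U_def)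
    show "continuous_on (ball 0 1 \<inter> closure U) u"
      by (rule continuous_on_subset[OF inner_function_continuous[OF assms(1)]]) auto
    show "cmod (u z) \<le> c" if "z \<in> ball 0 1 \<inter> frontier U" for z
      using that \<open>open U\<close> by (auto simp: frontier_def interior_open U_def)
    show "bounded (u ` U)"
      by (rule bounded_subset[OF inner_function_bounded[OF assms(1)]]) (auto simp: U_def)
    show "AE t in lebesgue_on {0..2 * pi}. \<forall>\<^sub>F r in at_left 1. complex_of_real r * cis t \<notin> U"
      using inner_function_AE_tendsto[OF assms(1)]
    proof eventually_elim
      case (elim t)
      from order_tendstoD(2)[OF this \<open>1 < c\<close>] show ?case
        by eventually_elim (auto simp: U_def)
    qed
    show "z \<in> U" using c assms by (simp add: U_def)
  qed
  with c show False by simp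
qed

lemma inner_function_less_1:
  assumes "inner_function u" "\<not> u constant_on ball 0 1" "cmod z < 1"
  shows "cmod (u z) < 1"
proof (rule ccontr)
  assume "\<not> ?thesis"
  with inner_function_le_1[OF assms(1,3)] have "cmod (u z) = 1" by simp
  then have "u constant_on ball 0 1"
    using maximum_modulus_principle[OF inner_function_holomorphic[OF assms(1)] open_ball connected_ball open_ball subset_refl, of z]
      inner_function_le_1[OF assms(1)] assms(3) by simp
  with assms show False by simp
qed

lemma inner_function_mult:
  assumes "inner_function u" "inner_function v"
  shows "inner_function (\<lambda>z. u z * v z)"
proof -
  have "bounded ((\<lambda>z. u z * v z) ` ball 0 1)"
    using inner_function_le_1[OF assms(1)] inner_function_le_1[OF assms(2)]
    by (intro boundedI[of _ 1]) (auto simp: norm_mult intro!: mult_le_one)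
  moreover have "AE t in lebesgue_on {0..2 * pi}.
        \<exists>L. ((\<lambda>r. u (complex_of_real r * cis t) * v (complex_of_real r * cis t)) \<longlongrightarrow> L) (at_left 1) \<and> cmod L = 1"
    using assms(1)[unfolded inner_function_def, THEN conjunct2] assms(2)[unfolded inner_function_def, THEN conjunct2]
  proof eventually_elim
    case (elim t)
    then obtain L M where "((\<lambda>r. u (complex_of_real r * cis t)) \<longlongrightarrow> L) (at_left 1)" "cmod L = 1"
      "((\<lambda>r. v (complex_of_real r * cis t)) \<longlongrightarrow> M) (at_left 1)" "cmod M = 1" by auto
    then show ?case by (intro exI[of _ "L * M"]) (auto intro: tendsto_mult simp: norm_mult)
  qed
  ultimately show ?thesis
    using assms[THEN inner_function_holomorphic] by (simp add: inner_function_def H_infinity_def holomorphic_on_mult)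
qed

text \<open>Limits of modulus 1 survive inversion, and \<open>e\<close> keeps the inverse bounded.
  With \<open>inner_function_le_1\<close> this shows that an inner function bounded away from 0 has
  modulus 1 throughout.\<close>

lemma inner_function_inverse:
  assumes "inner_function u" "0 < e" "\<And>z. cmod z < 1 \<Longrightarrow> e \<le> cmod (u z)"
  shows "inner_function (\<lambda>z. inverse (u z))"
proof -
  have nz: "u z \<noteq> 0" if "cmod z < 1" for z using assms(2) assms(3)[of z] that by auto
  have "bounded ((\<lambda>z. inverse (u z)) ` ball 0 1)"
    using assms(2,3) by (intro boundedI[of _ "inverse e"]) (auto simp: norm_inverse intro!: le_imp_inverse_le)
  moreover have "(\<lambda>z. inverse (u z)) holomorphic_on ball 0 1"
    using nz by (intro holomorphic_intros inner_function_holomorphic assms) auto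
  moreover have "AE t in lebesgue_on {0..2 * pi}.
        \<exists>L. ((\<lambda>r. inverse (u (complex_of_real r * cis t))) \<longlongrightarrow> L) (at_left 1) \<and> cmod L = 1"
    using assms(1)[unfolded inner_function_def, THEN conjunct2]
  proof eventually_elim
    case (elim t)
    then obtain L where L: "((\<lambda>r. u (complex_of_real r * cis t)) \<longlongrightarrow> L) (at_left 1)" "cmod L = 1" by auto
    then have "((\<lambda>r. inverse (u (complex_of_real r * cis t))) \<longlongrightarrow> inverse L) (at_left 1)"
      by (intro tendsto_inverse) auto
    with L show ?case by (auto intro!: exI[of _ "inverse L"] simp: norm_inverse)
  qed
  ultimately show ?thesis by (simp add: inner_function_def H_infinity_def)
qed

lemma open_Omega:
  assumes "continuous_on (ball 0 1) u"
  shows "open (Omega u s)"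
proof -
  have "open (ball 0 1 \<inter> (\<lambda>z. cmod (u z)) -` {..<s})"
    by (intro continuous_open_preimage continuous_on_norm open_ball open_lessThan assms)
  moreover have "ball 0 1 \<inter> (\<lambda>z. cmod (u z)) -` {..<s} = Omega u s" by (auto simp: Omega_def)
  ultimately show ?thesis by simp
qed

text \<open>
  A component of the sublevel set that misses \<open>G\<close> would carry the bounded function \<open>1 / f\<close>, whose
  modulus is at most \<open>1 / s\<close> on the part of the boundary inside the disk.
\<close>

lemma connected_Omega:
  assumes "inner_function f" "s < 1" "G \<subseteq> Omega f s" "connected G" "0 < e"
    and lower: "\<And>z. z \<in> Omega f s - G \<Longrightarrow> e \<le> cmod (f z)"
  shows "connected (Omega f s)"
proof -
  note cont = inner_function_continuous[OF assms(1)]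
  have op: "open (Omega f s)" by (rule open_Omega[OF cont])
  have meet: "\<exists>y\<in>G. connected_component (Omega f s) x y" if x: "x \<in> Omega f s" for x
  proof (rule ccontr)
    assume no: "\<not> ?thesis"
    define C where "C = connected_component_set (Omega f s) x"
    have "C \<in> components (Omega f s)" using x by (auto simp: components_def C_def)
    have "open C" unfolding C_def by (rule open_connected_component[OF op])
    have C_sub: "C \<subseteq> Omega f s" unfolding C_def by (rule connected_component_subset)
    then have C_ball: "C \<subseteq> ball 0 1" by (auto simp: Omega_def)
    have "0 < s" using x by (auto simp: Omega_def intro: le_less_trans[OF norm_ge_zero])
    \<comment> \<open>Boundary points of a component are boundary points of the whole open sublevel
      set, hence lie outside it.\<close>
    have fr: "s \<le> cmod (f z)" if "z \<in> ball 0 1 \<inter> frontier C" for z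
    proof -
      have "z \<in> frontier (Omega f s)"
        using frontier_of_components_subset[OF \<open>C \<in> _\<close>] that by auto
      then show ?thesis using op that by (auto simp: frontier_def interior_open Omega_def)
    qed
    have lowC: "e \<le> cmod (f z)" if "z \<in> C" for z
      using that C_sub no by (intro lower) (auto simp: C_def)
    have nz: "f z \<noteq> 0" if "z \<in> ball 0 1 \<inter> closure C" for z
    proof (cases "z \<in> C")
      case True
      with lowC[of z] \<open>0 < e\<close> show ?thesis by auto
    next
      case False
      with fr[of z] that \<open>0 < s\<close> \<open>open C\<close> show ?thesis by (auto simp: frontier_def interior_open)
    qed
    have "cmod (inverse (f x)) \<le> inverse s"
    proof (rule radial_maximum_principle[OF \<open>open C\<close> C_ball, where f="\<lambda>z. inverse (f z)" and z=x])
      show "(\<lambda>z. inverse (f z)) holomorphic_on C"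
        using nz C_ball closure_subset[of C]
        by (intro holomorphic_on_inverse holomorphic_on_subset[OF inner_function_holomorphic[OF assms(1)]]) (auto simp: subset_iff)
      show "continuous_on (ball 0 1 \<inter> closure C) (\<lambda>z. inverse (f z))"
        using nz by (intro continuous_on_inverse continuous_on_subset[OF cont]) auto
      show "cmod (inverse (f z)) \<le> inverse s" if "z \<in> ball 0 1 \<inter> frontier C" for z
        using fr[OF that] \<open>0 < s\<close> by (simp add: norm_inverse le_imp_inverse_le)
      show "bounded ((\<lambda>z. inverse (f z)) ` C)"
        using lowC \<open>0 < e\<close> by (intro boundedI[of _ "inverse e"]) (auto simp: norm_inverse intro!: le_imp_inverse_le)
      show "AE t in lebesgue_on {0..2 * pi}. \<forall>\<^sub>F r in at_left 1. complex_of_real r * cis t \<notin> C"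
        by (rule inner_function_AE_notin[OF assms(1,2)]) (use C_sub in \<open>auto simp: Omega_def\<close>)
      show "x \<in> C" using x by (simp add: C_def)
    qed
    moreover have "x \<in> C" using x by (simp add: C_def)
    then have "f x \<noteq> 0" using nz C_ball closure_subset[of C] by (auto simp: subset_iff)
    ultimately have "s \<le> cmod (f x)"
      using \<open>0 < s\<close> by (auto simp: norm_inverse dest!: inverse_le_imp_le)
    with x show False by (simp add: Omega_def)
  qed
  \<comment> \<open>Each point is joined to the connected set \<open>G\<close> inside the sublevel
    set, so any two points are joined through \<open>G\<close>.\<close>
  show ?thesis
    unfolding connected_iff_connected_component
  proof (intro ballI)
    fix x y assume "x \<in> Omega f s" "y \<in> Omega f s"
    then obtain p q where p: "p \<in> G" "connected_component (Omega f s) x p"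
      and q: "q \<in> G" "connected_component (Omega f s) y q"
      using meet by metis
    have "connected_component (Omega f s) p q"
      using assms(3,4) p(1) q(1) by (auto simp: connected_component_def)
    with p q show "connected_component (Omega f s) x y"
      by (meson connected_component_sym connected_component_trans)
  qed
qed

lemma inner_function_product_less_1:
  assumes "inner_function u" "\<not> u constant_on ball 0 1" "inner_function v" "cmod z < 1"
  shows "cmod (u z * v z) < 1"
proof -
  have "cmod (u z) * cmod (v z) \<le> cmod (u z) * 1"
    using inner_function_le_1[OF assms(3,4)] by (intro mult_left_mono) auto
  with inner_function_less_1[OF assms(1,2,4)] show ?thesis by (simp add: norm_mult)
qed

text \<open>Intermediate value theorem for the modulus on the disk. Some value is below
  \<open>s\<close>, since otherwise \<open>1 / f\<close> would be inner, against
  \<open>cmod (f 0) < 1\<close>; some value is above \<open>s\<close> because of the radial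
  limits.\<close>

lemma level_set_nonempty:
  assumes "inner_function f" "cmod (f 0) < 1" "0 < s" "s < 1"
  shows "level_set f s \<noteq> {}"
proof -
  have "\<exists>z. cmod z < 1 \<and> cmod (f z) < s"
  proof (rule ccontr)
    assume "\<not> ?thesis"
    then have "inner_function (\<lambda>z. inverse (f z))"
      by (intro inner_function_inverse[OF assms(1,3)]) (meson not_less)
    \<comment> \<open>The case \<open>f 0 = 0\<close> arises because \<open>inverse 0 = 0\<close>;
      it contradicts the assumed lower bound \<open>s\<close> at 0.\<close>
    from inner_function_le_1[OF this, of 0] have "1 \<le> cmod (f 0) \<or> f 0 = 0"
      by (auto simp: norm_inverse norm_divide inverse_eq_divide divide_le_eq split: if_splits)
    with assms(2) have "f 0 = 0" by auto
    with \<open>\<not> ?thesis\<close> \<open>0 < s\<close> show False by (auto dest: spec[of _ 0])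
  qed
  then obtain a where a: "cmod a < 1" "cmod (f a) < s" by auto
  have "\<exists>z. cmod z < 1 \<and> s < cmod (f z)"
  proof -
    obtain t where "\<forall>\<^sub>F r in at_left 1. s < cmod (f (complex_of_real r * cis t))"
    proof -
      \<comment> \<open>The interval has positive measure, so a property of almost every angle holds
        for at least one.\<close>
      have "\<not> (AE t in lebesgue_on {0..2 * pi}. False)"
        by (simp add: eventually_False ae_filter_eq_bot_iff emeasure_restrict_space)
      with inner_function_AE_less[OF assms(1,4)] show ?thesis
        using that by (meson eventually_mono)
    qed
    moreover have "\<forall>\<^sub>F r in at_left (1::real). 0 < r \<and> r < 1"
      using eventually_at_left_field[of "\<lambda>r::real. 0 < r \<and> r < 1" 1] by (auto intro!: exI[of _ 0])
    ultimately have "\<forall>\<^sub>F r in at_left 1. 0 < r \<and> r < 1 \<and> s < cmod (f (complex_of_real r * cis t))"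
      by eventually_elim auto
    from eventually_happens'[OF trivial_limit_at_left_real this]
    obtain r :: real where "0 < r" "r < 1" "s < cmod (f (complex_of_real r * cis t))" by auto
    then show ?thesis by (intro exI[of _ "complex_of_real r * cis t"]) (simp add: norm_mult)
  qed
  then obtain b where b: "cmod b < 1" "s < cmod (f b)" by auto
  have "connected ((\<lambda>z. cmod (f z)) ` ball 0 1)"
    by (intro connected_continuous_image continuous_on_norm inner_function_continuous assms) auto
  then have "s \<in> (\<lambda>z. cmod (f z)) ` ball 0 1"
    by (rule connectedD_interval[of _ "cmod (f a)" "cmod (f b)"]) (use a b in auto)
  then show ?thesis by (auto simp: level_set_def)
qed


section \<open>Factors of a product whose sublevel set is connected\<close>

context
  fixes u v \<Theta> :: "complex \<Rightarrow> complex" and \<eta> \<sigma> \<delta> :: real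
  assumes u: "inner_function u" "\<not> u constant_on ball 0 1"
    and v: "inner_function v" "\<not> v constant_on ball 0 1"
    and \<eta>: "0 < \<eta>" "\<eta> < 1"
    and \<Theta>: "\<Theta> = (\<lambda>z. u z * v z)"
    and \<sigma>: "\<sigma> = (SUP z\<in>level_set \<Theta> \<eta>. cmod (v z))"
    and \<delta>: "\<delta> = (INF z\<in>level_set \<Theta> \<eta>. cmod (u z))"
begin

text \<open>Makes \<sigma> and \<delta> genuine bounds: the supremum and infimum of an empty set of
  reals carry no information.\<close>

lemma product_level_set_nonempty: "level_set \<Theta> \<eta> \<noteq> {}"
  unfolding \<Theta> using inner_function_product_less_1[OF u v(1), of 0] \<eta>
  by (intro level_set_nonempty[OF inner_function_mult[OF u(1) v(1)]]) auto

lemma product_level_setD: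
  assumes "z \<in> level_set \<Theta> \<eta>"
  shows "cmod (u z) * cmod (v z) = \<eta>" "cmod (u z) < 1" "cmod (v z) < 1"
  using assms inner_function_less_1[OF u, of z] inner_function_less_1[OF v, of z]
  by (auto simp: level_set_def \<Theta> norm_mult)

lemma product_level_set_SUP: "z \<in> level_set \<Theta> \<eta> \<Longrightarrow> cmod (v z) \<le> \<sigma>"
  unfolding \<sigma> by (rule cSUP_upper) (auto intro!: bdd_aboveI[of _ 1] less_imp_le product_level_setD(3))

lemma product_level_set_INF: "z \<in> level_set \<Theta> \<eta> \<Longrightarrow> \<delta> \<le> cmod (u z)"
  unfolding \<delta> by (rule cINF_lower) (auto intro!: bdd_belowI[of _ 0])

lemma product_level_set_bounds: "\<eta> < \<sigma>" "\<sigma> \<le> 1" "\<eta> \<le> \<delta>"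
proof -
  obtain z where z: "z \<in> level_set \<Theta> \<eta>" using product_level_set_nonempty by auto
  note * = product_level_setD[OF z]
  have "cmod (v z) \<noteq> 0" using * \<eta> by auto
  then have "cmod (u z) * cmod (v z) < 1 * cmod (v z)" using * by (intro mult_strict_right_mono) auto
  with * product_level_set_SUP[OF z] show "\<eta> < \<sigma>" by simp
  show "\<sigma> \<le> 1"
    unfolding \<sigma> by (rule cSUP_least[OF product_level_set_nonempty]) (auto intro: less_imp_le product_level_setD)
  show "\<eta> \<le> \<delta>"
    unfolding \<delta>
  proof (rule cINF_greatest[OF product_level_set_nonempty])
    fix z assume z: "z \<in> level_set \<Theta> \<eta>"
    have "cmod (u z) * cmod (v z) \<le> cmod (u z) * 1"
      using product_level_setD(3)[OF z] by (intro mult_left_mono) auto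
    with product_level_setD(1)[OF z] show "\<eta> \<le> cmod (u z)" by simp
  qed
qed

text \<open>On the level set \<open>cmod (v z)\<close> equals \<open>\<eta> / cmod (u z)\<close>, so
  the supremum of one factor is \<eta> divided by the infimum of the other. Both equivalences
  between conditions on \<sigma> and \<delta> come from this identity.\<close>

lemma product_level_set_SUP_INF: "\<sigma> * \<delta> = \<eta>"
proof (rule antisym)
  have pos: "0 < \<sigma>" "0 < \<delta>" using product_level_set_bounds \<eta> by auto
  have "\<sigma> \<le> \<eta> / \<delta>"
    unfolding \<sigma>
  proof (rule cSUP_least[OF product_level_set_nonempty])
    fix z assume z: "z \<in> level_set \<Theta> \<eta>"
    have "\<delta> * cmod (v z) \<le> cmod (u z) * cmod (v z)"
      using product_level_set_INF[OF z] by (intro mult_right_mono) auto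
    with product_level_setD(1)[OF z] pos show "cmod (v z) \<le> \<eta> / \<delta>" by (simp add: field_simps)
  qed
  with pos show "\<sigma> * \<delta> \<le> \<eta>" by (simp add: field_simps)
  have "\<eta> / \<sigma> \<le> \<delta>"
    unfolding \<delta>
  proof (rule cINF_greatest[OF product_level_set_nonempty])
    fix z assume z: "z \<in> level_set \<Theta> \<eta>"
    have "cmod (u z) * cmod (v z) \<le> cmod (u z) * \<sigma>"
      using product_level_set_SUP[OF z] by (intro mult_left_mono) auto
    with product_level_setD(1)[OF z] pos show "\<eta> / \<sigma> \<le> cmod (u z)" by (simp add: field_simps)
  qed
  with pos show "\<eta> \<le> \<sigma> * \<delta>" by (simp add: field_simps)
qed

lemma product_level_set_SUP_INF_iff:
  "\<sigma> \<in> {\<eta><..<1} \<longleftrightarrow> \<delta> \<in> {\<eta><..<1}" "\<sigma> = 1 \<longleftrightarrow> \<delta> = \<eta>"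
proof -
  have pos: "0 < \<sigma>" "0 < \<delta>" using product_level_set_bounds \<eta> by auto
  have "\<sigma> < 1 \<longleftrightarrow> \<eta> < \<delta>" "\<eta> < \<sigma> \<longleftrightarrow> \<delta> < 1"
    using mult_less_cancel_right_pos[OF pos(2), of \<sigma> 1] mult_less_cancel_left_pos[OF pos(1), of \<delta> 1]
      product_level_set_SUP_INF by auto
  then show "\<sigma> \<in> {\<eta><..<1} \<longleftrightarrow> \<delta> \<in> {\<eta><..<1}" by auto
  show "\<sigma> = 1 \<longleftrightarrow> \<delta> = \<eta>" using product_level_set_SUP_INF pos by auto
qed

lemma factor_one_component:
  assumes conn: "connected (Omega \<Theta> \<eta>)" and "\<sigma> < 1"
  shows "v \<in> one_component_inner"
proof -
  have inner\<Theta>: "inner_function \<Theta>" unfolding \<Theta> by (rule inner_function_mult[OF u(1) v(1)])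
  note cont\<Theta> = inner_function_continuous[OF inner\<Theta>]
  have op: "open (Omega \<Theta> \<eta>)" by (rule open_Omega[OF cont\<Theta>])
  \<comment> \<open>Any level strictly between \<sigma> and 1 works: the bound by \<sigma> on
    \<open>Omega \<Theta> \<eta>\<close> then becomes the strict inequality defining
    \<open>Omega v s\<close>.\<close>
  define s where "s = (1 + \<sigma>) / 2"
  have s: "0 < s" "\<sigma> < s" "s < 1" using \<open>\<sigma> < 1\<close> product_level_set_bounds \<eta> by (auto simp: s_def)
  have le\<sigma>: "cmod (v z) \<le> \<sigma>" if z: "z \<in> Omega \<Theta> \<eta>" for z
  proof (rule radial_maximum_principle[OF op _ _ _ _ _ _ z, where f=v])
    show "Omega \<Theta> \<eta> \<subseteq> ball 0 1" by (auto simp: Omega_def)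
    then show "v holomorphic_on Omega \<Theta> \<eta>" "bounded (v ` Omega \<Theta> \<eta>)"
      using inner_function_holomorphic[OF v(1)] inner_function_bounded[OF v(1)]
      by (auto intro: holomorphic_on_subset bounded_subset)
    show "continuous_on (ball 0 1 \<inter> closure (Omega \<Theta> \<eta>)) v"
      by (rule continuous_on_subset[OF inner_function_continuous[OF v(1)]]) auto
    show "cmod (v w) \<le> \<sigma>" if w: "w \<in> ball 0 1 \<inter> frontier (Omega \<Theta> \<eta>)" for w
    proof (rule product_level_set_SUP)
      \<comment> \<open>The boundary inside the disk lies on the level set: openness gives one
        inequality, approximation from within the sublevel set the other.\<close>
      have "\<eta> \<le> cmod (\<Theta> w)"
        using w op by (auto simp: frontier_def interior_open Omega_def)
      moreover have "cmod (\<Theta> w) \<le> \<eta>"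
      proof -
        have "w islimpt Omega \<Theta> \<eta>"
          using w op by (auto simp: frontier_def interior_open closure_def)
        then obtain x where x: "\<And>n. x n \<in> Omega \<Theta> \<eta>" "x \<longlonglongrightarrow> w"
          by (auto simp: islimpt_sequential)
        have "isCont \<Theta> w" by (rule continuous_on_interior[OF cont\<Theta>]) (use w in auto)
        then have "(\<lambda>n. cmod (\<Theta> (x n))) \<longlonglongrightarrow> cmod (\<Theta> w)"
          by (rule tendsto_norm[OF isCont_tendsto_compose[OF _ x(2)]])
        then show ?thesis
          by (rule LIMSEQ_le_const2) (use x(1) in \<open>auto simp: Omega_def intro: less_imp_le\<close>)
      qed
      ultimately show "w \<in> level_set \<Theta> \<eta>" using w by (simp add: level_set_def)
    qed
    show "AE t in lebesgue_on {0..2 * pi}. \<forall>\<^sub>F r in at_left 1. complex_of_real r * cis t \<notin> Omega \<Theta> \<eta>"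
      by (rule inner_function_AE_notin[OF inner\<Theta> \<eta>(2)]) (auto simp: Omega_def)
  qed
  have "connected (Omega v s)"
  proof (rule connected_Omega[OF v(1) s(3) _ conn \<eta>(1)])
    show "Omega \<Theta> \<eta> \<subseteq> Omega v s"
      using le\<sigma> s(2) by (fastforce simp: Omega_def)
    show "\<eta> \<le> cmod (v z)" if z: "z \<in> Omega v s - Omega \<Theta> \<eta>" for z
    proof -
      have "cmod z < 1" "\<eta> \<le> cmod (u z) * cmod (v z)" using z by (auto simp: Omega_def \<Theta> norm_mult)
      moreover have "cmod (u z) * cmod (v z) \<le> 1 * cmod (v z)"
        using inner_function_le_1[OF u(1) \<open>cmod z < 1\<close>] by (intro mult_right_mono) auto
      ultimately show ?thesis by simp
    qed
  qed
  with v s show ?thesis by (auto simp: one_component_inner_def)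
qed

end

subsection \<open>A sparse Blaschke product in the right half-plane\<close>

text \<open>The quadratic exponent makes the ratio \<open>4 ^ (2 * k + 1)\<close> of consecutive
  zeros unbounded.\<close>

definition blaschke_zero :: "nat \<Rightarrow> real" where
  "blaschke_zero k = 4 ^ (k\<^sup>2)"

text \<open>A Blaschke factor of the right half-plane. With the numerator in this sign each factor
  is 1 at \<open>w = 0\<close> and the factors tend to 1, so the product needs no unimodular
  constants.\<close>

definition half_plane_factor :: "nat \<Rightarrow> complex \<Rightarrow> complex" where
  "half_plane_factor k w = (of_real (blaschke_zero k) - w) / (of_real (blaschke_zero k) + w)"

definition half_plane_product :: "complex \<Rightarrow> complex" where
  "half_plane_product w = (\<Prod>k. half_plane_factor k w)"

lemma blaschke_zero_ge_power: "4 ^ k \<le> blaschke_zero k"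
  unfolding blaschke_zero_def by (rule power_increasing) (auto simp: power2_eq_square)

lemma blaschke_zero_ge_1: "1 \<le> blaschke_zero k"
  by (simp add: blaschke_zero_def)

lemma inverse_blaschke_zero_le: "1 / blaschke_zero k \<le> (1 / 4) ^ k"
  using blaschke_zero_ge_power[of k] blaschke_zero_ge_1[of k] by (simp add: power_divide frac_le)

lemma summable_inverse_blaschke_zero: "summable (\<lambda>k. c * (1 / blaschke_zero k))"
  by (intro summable_mult summable_comparison_test[OF _ summable_geometric[of "1 / 4"]])
    (auto intro!: exI[of _ 0] order_trans[OF _ inverse_blaschke_zero_le] simp: blaschke_zero_def)

text \<open>The poles are at most -1, so the half-plane \<open>- (1 / 2) < Re w\<close> avoids them.
  Being an open neighbourhood of the closed right half-plane, it gives continuity up to the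
  imaginary axis.\<close>

lemma blaschke_zero_plus_nonzero:
  assumes "- (1 / 2) < Re w"
  shows "of_real (blaschke_zero k) + w \<noteq> 0" "blaschke_zero k / 2 \<le> cmod (of_real (blaschke_zero k) + w)"
proof -
  have "blaschke_zero k / 2 \<le> Re (of_real (blaschke_zero k) + w)"
    using assms blaschke_zero_ge_1[of k] by simp
  also have "\<dots> \<le> cmod (of_real (blaschke_zero k) + w)" by (rule complex_Re_le_cmod)
  finally show *: "blaschke_zero k / 2 \<le> cmod (of_real (blaschke_zero k) + w)" .
  show "of_real (blaschke_zero k) + w \<noteq> 0"
    using * blaschke_zero_ge_1[of k] by auto
qed

lemma norm_half_plane_factor_minus_1:
  assumes "- (1 / 2) < Re w"
  shows "cmod (half_plane_factor k w - 1) \<le> 4 * cmod w * (1 / blaschke_zero k)"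
proof -
  note * = blaschke_zero_plus_nonzero[OF assms, of k]
  have "half_plane_factor k w - 1 = - (2 * w) / (of_real (blaschke_zero k) + w)"
    using *(1) by (simp add: half_plane_factor_def field_simps)
  then have "cmod (half_plane_factor k w - 1) = 2 * cmod w / cmod (of_real (blaschke_zero k) + w)"
    by (simp add: norm_divide norm_mult)
  also have "\<dots> \<le> 2 * cmod w / (blaschke_zero k / 2)"
    using * blaschke_zero_ge_1[of k] by (intro divide_left_mono) auto
  finally show ?thesis by (simp add: field_simps)
qed

lemma half_plane_product_has_prod:
  assumes "- (1 / 2) < Re w"
  shows "(\<lambda>k. half_plane_factor k w) has_prod half_plane_product w"
proof -
  have "summable (\<lambda>k. cmod (half_plane_factor k w - 1))"
    by (rule summable_comparison_test[OF _ summable_inverse_blaschke_zero[of "4 * cmod w"]])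
      (use norm_half_plane_factor_minus_1[OF assms] in \<open>auto intro!: exI[of _ 0]\<close>)
  then show ?thesis
    unfolding half_plane_product_def
    by (intro convergent_prod_has_prod abs_convergent_prod_imp_convergent_prod)
      (simp add: abs_convergent_prod_conv_summable)
qed

lemmas half_plane_product_LIMSEQ = has_prod_imp_tendsto'[OF half_plane_product_has_prod]

text \<open>On a closed disk of center \<open>x\<close> and radius \<open>d\<close>, the k-th factor
  differs from 1 by at most \<open>4 * (cmod x + d) / blaschke_zero k\<close>. The Weierstrass test
  then gives locally uniform convergence of the partial products.\<close>

lemma half_plane_product_holomorphic: "half_plane_product holomorphic_on {w. - (1 / 2) < Re w}"
proof (rule holomorphic_uniform_sequence)
  show "open {w. - (1 / 2) < Re w}" by (rule open_halfspace_Re_gt)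
  have hol: "half_plane_factor k holomorphic_on {w. - (1 / 2) < Re w}" for k
    unfolding half_plane_factor_def[abs_def] by (intro holomorphic_intros) (use blaschke_zero_plus_nonzero in auto)
  then show "(\<lambda>w. \<Prod>k<n. half_plane_factor k w) holomorphic_on {w. - (1 / 2) < Re w}" for n
    by (intro holomorphic_intros)
  fix x assume "x \<in> {w. - (1 / 2) < Re w}"
  with open_contains_cball[of "{w. - (1 / 2) < Re w}"] open_halfspace_Re_gt
  obtain d where d: "0 < d" "cball x d \<subseteq> {w. - (1 / 2) < Re w}" by blast
  have "uniformly_convergent_on (cball x d) (\<lambda>N w. \<Sum>k<N. norm (half_plane_factor k w - 1))"
  proof (rule Weierstrass_m_test'[where M="\<lambda>k. 4 * (cmod x + d) * (1 / blaschke_zero k)"])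
    fix k w assume w: "w \<in> cball x d"
    have "cmod w \<le> cmod x + d"
      using w norm_triangle_ineq2[of w x] by (simp add: dist_norm norm_minus_commute)
    then have "4 * cmod w * (1 / blaschke_zero k) \<le> 4 * (cmod x + d) * (1 / blaschke_zero k)"
      using blaschke_zero_ge_1[of k] by (intro mult_right_mono) auto
    with norm_half_plane_factor_minus_1[of w k] w d(2) show "norm (norm (half_plane_factor k w - 1)) \<le> 4 * (cmod x + d) * (1 / blaschke_zero k)"
      by auto
  qed (rule summable_inverse_blaschke_zero)
  then have "uniformly_convergent_on (cball x d) (\<lambda>N w. \<Prod>k<N. half_plane_factor k w)"
    using d(2) by (intro uniformly_convergent_on_prod' continuous_on_subset[OF holomorphic_on_imp_continuous_on[OF hol]]) auto
  then have "uniform_limit (cball x d) (\<lambda>N w. \<Prod>k<N. half_plane_factor k w) (\<lambda>w. lim (\<lambda>N. \<Prod>k<N. half_plane_factor k w)) sequentially"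
    by (simp add: uniformly_convergent_uniform_limit_iff)
  moreover have "lim (\<lambda>N. \<Prod>k<N. half_plane_factor k w) = half_plane_product w" if "w \<in> cball x d" for w
    using d(2) that by (intro limI half_plane_product_LIMSEQ) auto
  ultimately have "uniform_limit (cball x d) (\<lambda>N w. \<Prod>k<N. half_plane_factor k w) half_plane_product sequentially"
    by (subst (asm) uniform_limit_cong'[where i=half_plane_product]) auto
  with d show "\<exists>d>0. cball x d \<subseteq> {w. - (1 / 2) < Re w} \<and>
      uniform_limit (cball x d) (\<lambda>N w. \<Prod>k<N. half_plane_factor k w) half_plane_product sequentially"
    by blast
qed

text \<open>For real \<open>a\<close>, \<open>|a + w|^2 - |a - w|^2 = 4 * a * Re w\<close>; in the
  second part the cross term \<open>2 * a * Re w\<close> is nonnegative.\<close>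

lemma one_minus_norm_half_plane_factor:
  assumes "0 \<le> Re w"
  shows "1 - (cmod (half_plane_factor k w))\<^sup>2 = 4 * blaschke_zero k * Re w / (cmod (of_real (blaschke_zero k) + w))\<^sup>2"
    and "(blaschke_zero k)\<^sup>2 + (cmod w)\<^sup>2 \<le> (cmod (of_real (blaschke_zero k) + w))\<^sup>2"
proof -
  have nz: "(cmod (of_real (blaschke_zero k) + w))\<^sup>2 \<noteq> 0"
    using blaschke_zero_plus_nonzero(1)[of w k] assms by simp
  have "(cmod (of_real (blaschke_zero k) + w))\<^sup>2 - (cmod (of_real (blaschke_zero k) - w))\<^sup>2 = 4 * blaschke_zero k * Re w"
    unfolding cmod_power2 by (simp add: power2_eq_square algebra_simps)
  then have "((cmod (of_real (blaschke_zero k) + w))\<^sup>2 - (cmod (of_real (blaschke_zero k) - w))\<^sup>2)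
      / (cmod (of_real (blaschke_zero k) + w))\<^sup>2 = 4 * blaschke_zero k * Re w / (cmod (of_real (blaschke_zero k) + w))\<^sup>2"
    by (rule arg_cong)
  then show "1 - (cmod (half_plane_factor k w))\<^sup>2 = 4 * blaschke_zero k * Re w / (cmod (of_real (blaschke_zero k) + w))\<^sup>2"
    unfolding diff_divide_distrib divide_self[OF nz] by (simp only: half_plane_factor_def norm_divide power_divide)
  have "0 \<le> blaschke_zero k * Re w" using assms blaschke_zero_ge_1[of k] by simp
  then show "(blaschke_zero k)\<^sup>2 + (cmod w)\<^sup>2 \<le> (cmod (of_real (blaschke_zero k) + w))\<^sup>2"
    unfolding cmod_power2 by (simp add: power2_eq_square algebra_simps)
qed

lemma norm_half_plane_factor_le_1: "0 \<le> Re w \<Longrightarrow> cmod (half_plane_factor k w) \<le> 1"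
proof -
  assume w: "0 \<le> Re w"
  have "0 \<le> 1 - (cmod (half_plane_factor k w))\<^sup>2"
    unfolding one_minus_norm_half_plane_factor[OF w] using w blaschke_zero_ge_1[of k] by simp
  then show ?thesis by (simp add: abs_square_le_1)
qed

lemma norm_half_plane_product_le_1:
  assumes "0 \<le> Re w"
  shows "cmod (half_plane_product w) \<le> 1"
  by (rule LIMSEQ_le_const2[OF tendsto_norm[OF half_plane_product_LIMSEQ]])
    (use assms norm_half_plane_factor_le_1 in \<open>auto simp: prod_norm[symmetric] intro!: prod_le_1\<close>)

lemma norm_half_plane_product_imaginary:
  assumes "Re w = 0"
  shows "cmod (half_plane_product w) = 1"
proof -
  have "cmod (half_plane_factor k w) = 1" for k
    using one_minus_norm_half_plane_factor(1)[of w k] assms by (simp add: power2_eq_1_iff) (use norm_ge_zero[of "half_plane_factor k w"] in linarith)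
  then have "(\<lambda>n. cmod (\<Prod>k<n. half_plane_factor k w)) \<longlonglongrightarrow> 1"
    by (simp add: prod_norm[symmetric])
  moreover have "(\<lambda>n. cmod (\<Prod>k<n. half_plane_factor k w)) \<longlonglongrightarrow> cmod (half_plane_product w)"
    using assms by (intro tendsto_norm half_plane_product_LIMSEQ) auto
  ultimately show ?thesis by (rule LIMSEQ_unique[symmetric])
qed

lemma half_plane_product_zero: "half_plane_product (of_real (blaschke_zero k)) = 0"
proof -
  have "(\<lambda>n. \<Prod>j<n. half_plane_factor j (of_real (blaschke_zero k))) \<longlonglongrightarrow> 0"
  proof (rule tendsto_eventually)
    show "\<forall>\<^sub>F n in sequentially. (\<Prod>j<n. half_plane_factor j (of_real (blaschke_zero k))) = 0"
      using eventually_gt_at_top[of k] by eventually_elim (auto simp: half_plane_factor_def)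
  qed
  moreover have "(\<lambda>n. \<Prod>j<n. half_plane_factor j (of_real (blaschke_zero k))) \<longlonglongrightarrow> half_plane_product (of_real (blaschke_zero k))"
    using blaschke_zero_ge_1[of k] by (intro half_plane_product_LIMSEQ) auto
  ultimately show ?thesis using LIMSEQ_unique by blast
qed

text \<open>Weierstrass' inequality: a product of terms \<open>1 - x\<close> is at least 1 minus the
  sum of the \<open>x\<close>, and the geometric series sums to at most
  \<open>2 * c\<close>.\<close>

lemma half_plane_product_lower_bound:
  assumes w: "0 \<le> Re w" and c: "0 \<le> c"
    and le: "\<And>k. 1 - (cmod (half_plane_factor k w))\<^sup>2 \<le> c * (1 / 2) ^ k"
  shows "1 - 2 * c \<le> (cmod (half_plane_product w))\<^sup>2"
proof (rule LIMSEQ_le_const)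
  show "(\<lambda>n. (cmod (\<Prod>k<n. half_plane_factor k w))\<^sup>2) \<longlonglongrightarrow> (cmod (half_plane_product w))\<^sup>2"
    using w by (intro tendsto_power tendsto_norm half_plane_product_LIMSEQ) auto
  have "1 - 2 * c \<le> (cmod (\<Prod>k<n. half_plane_factor k w))\<^sup>2" for n
  proof -
    have "(\<Sum>k<n. 1 - (cmod (half_plane_factor k w))\<^sup>2) \<le> (\<Sum>k<n. c * (1 / 2) ^ k)"
      by (intro sum_mono le)
    also have "\<dots> = c * (2 * (1 - (1 / 2) ^ n))"
      by (simp add: sum_distrib_left[symmetric] sum_gp_strict)
    also have "\<dots> \<le> c * 2" using c by (intro mult_left_mono) auto
    finally have "1 - 2 * c \<le> 1 - (\<Sum>k<n. 1 - (cmod (half_plane_factor k w))\<^sup>2)" by simp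
    also have "\<dots> \<le> (\<Prod>k<n. 1 - (1 - (cmod (half_plane_factor k w))\<^sup>2))"
      using norm_half_plane_factor_le_1[OF w] by (intro Weierstrass_prod_ineq) (auto simp: abs_square_le_1)
    also have "\<dots> = (cmod (\<Prod>k<n. half_plane_factor k w))\<^sup>2"
      by (simp add: prod_norm[symmetric] prod_power_distrib)
    finally show ?thesis .
  qed
  then show "\<exists>N. \<forall>n\<ge>N. 1 - 2 * c \<le> (cmod (\<Prod>k<n. half_plane_factor k w))\<^sup>2" by blast
qed

text \<open>Each defect \<open>1 - |factor|^2\<close> is at most
  \<open>4 * Re w / blaschke_zero k\<close>, so \<open>Re w \<le> 1 / 16\<close> allows
  \<open>c = 1 / 4\<close>. The squared modulus is then at least \<open>1 / 2\<close>, more than the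
  \<open>1 / 4\<close> required.\<close>

lemma half_plane_product_near_axis:
  assumes "0 \<le> Re w" "Re w \<le> 1 / 16"
  shows "1 / 2 \<le> cmod (half_plane_product w)"
proof -
  have "1 - 2 * (1 / 4) \<le> (cmod (half_plane_product w))\<^sup>2"
  proof (rule half_plane_product_lower_bound[OF assms(1)])
    fix k
    let ?a = "blaschke_zero k"
    have a: "1 \<le> ?a" by (rule blaschke_zero_ge_1)
    have "?a\<^sup>2 \<le> (cmod (of_real ?a + w))\<^sup>2"
      using one_minus_norm_half_plane_factor(2)[OF assms(1), of k] zero_le_power2[of "cmod w"] by linarith
    then have "1 - (cmod (half_plane_factor k w))\<^sup>2 \<le> 4 * ?a * Re w / ?a\<^sup>2"
      unfolding one_minus_norm_half_plane_factor(1)[OF assms(1)] using a assms blaschke_zero_plus_nonzero(1)[of w k] by (intro divide_left_mono) auto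
    also have "\<dots> = 4 * Re w * (1 / ?a)" using a by (simp add: power2_eq_square)
    also have "\<dots> \<le> 1 / 4 * (1 / 4) ^ k"
      using assms a by (intro mult_mono inverse_blaschke_zero_le) auto
    also have "\<dots> \<le> 1 / 4 * (1 / 2) ^ k" by (intro mult_left_mono power_mono) auto
    finally show "1 - (cmod (half_plane_factor k w))\<^sup>2 \<le> 1 / 4 * (1 / 2) ^ k" .
  qed simp
  then have "(1 / 2)\<^sup>2 \<le> (cmod (half_plane_product w))\<^sup>2" by (simp add: power2_eq_square)
  then show ?thesis by (rule power2_le_imp_le) simp
qed

text \<open>
  Roughly the geometric mean of two consecutive zeros, with an integral exponent.
\<close>

definition gap_radius :: "nat \<Rightarrow> real" where
  "gap_radius n = 4 ^ (n\<^sup>2 + n)"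

text \<open>For \<open>n = 0\<close> both numbers are 1, so strictness starts at
  \<open>n = 1\<close>.\<close>

lemma blaschke_zero_less_gap_radius: "1 \<le> n \<Longrightarrow> blaschke_zero n < gap_radius n"
  unfolding gap_radius_def blaschke_zero_def by (rule power_strict_increasing) auto

lemma gap_radius_less_blaschke_zero: "gap_radius n < blaschke_zero (Suc n)"
  unfolding gap_radius_def blaschke_zero_def
  by (rule power_strict_increasing) (auto simp: power2_eq_square)

text \<open>Keeping only the larger square in the denominator leaves the ratio of the smaller to the
  larger number. It is at most \<open>4 ^ -n\<close> if \<open>k \<le> n\<close> and
  \<open>4 ^ -k\<close> otherwise; splitting the power of 4 into two powers of 2 gives decay in both
  indices.\<close>

lemma gap_radius_ratio:
  "blaschke_zero k * gap_radius n / ((blaschke_zero k)\<^sup>2 + (gap_radius n)\<^sup>2) \<le> (1 / 2) ^ n * (1 / 2) ^ k"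
proof -
  have pos: "0 < blaschke_zero k" "0 < gap_radius n" by (auto simp: blaschke_zero_def gap_radius_def)
  have "(1 / 4) ^ m \<le> (1 / 2) ^ n * ((1 / 2) ^ k :: real)" if "n \<le> m" "k \<le> m" for m
  proof -
    have "(1 / 4) ^ m = ((1 / 2) ^ m * (1 / 2) ^ m :: real)" by (simp flip: power_mult_distrib)
    also have "\<dots> \<le> (1 / 2) ^ n * (1 / 2) ^ k" using that by (intro mult_mono power_decreasing) auto
    finally show ?thesis .
  qed
  note bound = this
  show ?thesis
  proof (cases "k \<le> n")
    case True
    have "blaschke_zero k * gap_radius n / ((blaschke_zero k)\<^sup>2 + (gap_radius n)\<^sup>2) \<le> blaschke_zero k * gap_radius n / (gap_radius n)\<^sup>2"
      using pos by (intro divide_left_mono) (auto intro!: mult_pos_pos add_pos_pos)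
    also have "\<dots> = blaschke_zero k / gap_radius n" using pos by (simp add: power2_eq_square)
    also have "\<dots> \<le> 4 ^ n\<^sup>2 / gap_radius n"
      using pos True unfolding blaschke_zero_def by (intro divide_right_mono power_increasing power_mono) auto
    also have "\<dots> = (1 / 4) ^ n" by (simp add: gap_radius_def power_add power_divide)
    also have "\<dots> \<le> (1 / 2) ^ n * (1 / 2) ^ k" using True by (intro bound) auto
    finally show ?thesis .
  next
    case False
    then obtain m where m: "k = Suc m" "n \<le> m" by (cases k) auto
    have "blaschke_zero k * gap_radius n / ((blaschke_zero k)\<^sup>2 + (gap_radius n)\<^sup>2) \<le> blaschke_zero k * gap_radius n / (blaschke_zero k)\<^sup>2"
      using pos by (intro divide_left_mono) (auto intro!: mult_pos_pos add_pos_pos)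
    also have "\<dots> = gap_radius n / blaschke_zero k" using pos by (simp add: power2_eq_square)
    also have "\<dots> \<le> 4 ^ (m\<^sup>2 + m) / blaschke_zero k"
      using pos m unfolding gap_radius_def by (intro divide_right_mono power_increasing add_mono power_mono) auto
    also have "\<dots> = (1 / 4) ^ k"
    proof -
      have "k\<^sup>2 = m\<^sup>2 + m + k" by (simp add: m(1) power2_eq_square)
      then have "blaschke_zero k = 4 ^ (m\<^sup>2 + m) * 4 ^ k" unfolding blaschke_zero_def by (simp only: power_add)
      then show ?thesis by (simp add: power_divide)
    qed
    also have "\<dots> \<le> (1 / 2) ^ n * (1 / 2) ^ k" using False by (intro bound) auto
    finally show ?thesis .
  qed
qed

text \<open>On this semicircle \<open>Re w\<close> is at most the radius, so
  \<open>gap_radius_ratio\<close> bounds the defects with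
  \<open>c = 4 * (1 / 2) ^ n\<close>.\<close>

lemma half_plane_product_gap:
  assumes "0 \<le> Re w" "cmod w = gap_radius n"
  shows "1 - 8 * (1 / 2) ^ n \<le> (cmod (half_plane_product w))\<^sup>2"
proof -
  have "1 - 2 * (4 * (1 / 2) ^ n) \<le> (cmod (half_plane_product w))\<^sup>2"
  proof (rule half_plane_product_lower_bound[OF assms(1)])
    fix k
    let ?a = "blaschke_zero k"
    have a: "1 \<le> ?a" by (rule blaschke_zero_ge_1)
    have R: "0 < gap_radius n" by (simp add: gap_radius_def)
    have "1 - (cmod (half_plane_factor k w))\<^sup>2 = 4 * ?a * Re w / (cmod (of_real ?a + w))\<^sup>2"
      by (rule one_minus_norm_half_plane_factor(1)[OF assms(1)])
    also have "\<dots> \<le> 4 * ?a * gap_radius n / (?a\<^sup>2 + (gap_radius n)\<^sup>2)"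
    proof (rule frac_le)
      show "4 * ?a * Re w \<le> 4 * ?a * gap_radius n"
        using a assms complex_Re_le_cmod[of w] by (intro mult_left_mono) auto
      show "0 \<le> 4 * ?a * gap_radius n" using a R by simp
      show "0 < ?a\<^sup>2 + (gap_radius n)\<^sup>2" using a R by (intro add_pos_pos) auto
      show "?a\<^sup>2 + (gap_radius n)\<^sup>2 \<le> (cmod (of_real ?a + w))\<^sup>2"
        using one_minus_norm_half_plane_factor(2)[OF assms(1), of k] assms(2) by simp
    qed
    also have "\<dots> = 4 * (?a * gap_radius n / (?a\<^sup>2 + (gap_radius n)\<^sup>2))" by simp
    also have "\<dots> \<le> 4 * ((1 / 2) ^ n * (1 / 2) ^ k)"
      by (intro mult_left_mono gap_radius_ratio) simp
    finally show "1 - (cmod (half_plane_factor k w))\<^sup>2 \<le> 4 * (1 / 2) ^ n * (1 / 2) ^ k" by (simp only: mult.assoc)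
  qed simp
  then show ?thesis by simp
qed

subsection \<open>Transfer to the disk\<close>

definition to_half_plane :: "complex \<Rightarrow> complex" where
  "to_half_plane z = (1 + z) / (1 - z)"

definition from_half_plane :: "complex \<Rightarrow> complex" where
  "from_half_plane w = (w - 1) / (w + 1)"

text \<open>The Poisson kernel of the disk with pole at 1.\<close>

lemma Re_to_half_plane: "Re (to_half_plane z) = (1 - (cmod z)\<^sup>2) / (cmod (1 - z))\<^sup>2"
proof -
  have "to_half_plane z = (1 + z) * cnj (1 - z) / of_real ((cmod (1 - z))\<^sup>2)"
    unfolding to_half_plane_def by (subst complex_div_cnj) simp
  then have "Re (to_half_plane z) = Re ((1 + z) * cnj (1 - z)) / (cmod (1 - z))\<^sup>2"
    by (simp only: Re_divide_of_real)
  also have "Re ((1 + z) * cnj (1 - z)) = 1 - (cmod z)\<^sup>2"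
    unfolding cmod_power2 by (simp add: power2_eq_square algebra_simps)
  finally show ?thesis .
qed

lemma Re_to_half_plane_pos:
  assumes "cmod z < 1"
  shows "0 < Re (to_half_plane z)"
proof -
  have "z \<noteq> 1" using assms by auto
  moreover have "(cmod z)\<^sup>2 < 1" using assms by (simp add: abs_square_less_1)
  ultimately show ?thesis by (simp add: Re_to_half_plane)
qed

lemma from_half_plane:
  assumes "0 < Re w"
  shows "cmod (from_half_plane w) < 1" "to_half_plane (from_half_plane w) = w"
proof -
  have w: "w + 1 \<noteq> 0" using assms by (auto simp: complex_eq_iff)
  have "(cmod (w - 1))\<^sup>2 < (cmod (w + 1))\<^sup>2"
    unfolding cmod_power2 using assms by (simp add: power2_eq_square algebra_simps)
  then have "cmod (w - 1) < cmod (w + 1)" by (rule power2_less_imp_less) simp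
  with w show "cmod (from_half_plane w) < 1"
    by (simp add: from_half_plane_def norm_divide divide_less_eq)
  show "to_half_plane (from_half_plane w) = w"
  proof -
    have "1 + from_half_plane w = 2 * w / (w + 1)" "1 - from_half_plane w = 2 / (w + 1)"
      using w by (simp_all add: from_half_plane_def field_simps)
    with w show ?thesis by (simp add: to_half_plane_def)
  qed
qed

lemma from_half_plane_to_half_plane:
  assumes "z \<noteq> 1"
  shows "from_half_plane (to_half_plane z) = z"
proof -
  have "to_half_plane z - 1 = 2 * z / (1 - z)" "to_half_plane z + 1 = 2 / (1 - z)"
    using assms by (simp_all add: to_half_plane_def field_simps)
  with assms show ?thesis by (simp add: from_half_plane_def)
qed

text \<open>The unit circle without 1 goes to the imaginary axis, across which \<open>F\<close> is
  continuous. So radial limits of modulus 1 exist at every boundary point except 1.\<close>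

lemma inner_function_from_half_plane:
  assumes holo: "F holomorphic_on {w. - (1 / 2) < Re w}"
    and le: "\<And>w. 0 \<le> Re w \<Longrightarrow> cmod (F w) \<le> 1"
    and eq: "\<And>w. Re w = 0 \<Longrightarrow> cmod (F w) = 1"
  shows "inner_function (\<lambda>z. F (to_half_plane z))"
proof -
  have hol: "to_half_plane holomorphic_on - {1}"
    unfolding to_half_plane_def[abs_def] by (intro holomorphic_intros) auto
  have "F \<circ> to_half_plane holomorphic_on ball 0 1"
  proof (rule holomorphic_on_compose_gen[OF _ holo])
    show "to_half_plane holomorphic_on ball 0 1"
      by (rule holomorphic_on_subset[OF hol]) auto
    show "to_half_plane ` ball 0 1 \<subseteq> {w. - (1 / 2) < Re w}"
      using Re_to_half_plane_pos by force
  qed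
  then have 1: "(\<lambda>z. F (to_half_plane z)) holomorphic_on ball 0 1" by (simp add: o_def)
  have 2: "bounded ((\<lambda>z. F (to_half_plane z)) ` ball 0 1)"
    using le[OF less_imp_le[OF Re_to_half_plane_pos]] by (intro boundedI[of _ 1]) auto
  \<comment> \<open>These are the two parameters of the exceptional point 1.\<close>
  have "{0, 2 * pi} \<in> null_sets (lebesgue_on {0..2 * pi})"
    by (simp add: null_sets_restrict_space null_sets_completionI finite_imp_null_set_lborel)
  from AE_not_in[OF this] have 3: "AE t in lebesgue_on {0..2 * pi}.
      \<exists>L. ((\<lambda>r. F (to_half_plane (of_real r * cis t))) \<longlongrightarrow> L) (at_left 1) \<and> cmod L = 1"
  proof (rule AE_mp, intro AE_I2 impI)
    fix t assume t: "t \<in> space (lebesgue_on {0..2 * pi})" "t \<notin> {0, 2 * pi}"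
    have "cis t \<noteq> 1"
    proof
      assume "cis t = 1"
      then have "cos t = 1" by (simp add: complex_eq_iff)
      then obtain n :: int where n: "t = of_int n * 2 * pi" using cos_one_2pi_int by blast
      have "0 < t" "t < 2 * pi" using t by auto
      with n have "0 < real_of_int n * (2 * pi)" "real_of_int n * (2 * pi) < 1 * (2 * pi)"
        by (simp_all only: mult.assoc mult_1)
      then have "0 < n" "n < 1" by (simp_all add: zero_less_mult_iff)
      then show False by simp
    qed
    then have Re0: "Re (to_half_plane (cis t)) = 0" by (simp add: Re_to_half_plane)
    have "isCont to_half_plane (cis t)"
      using holomorphic_on_imp_continuous_on[OF hol] \<open>cis t \<noteq> 1\<close>
      by (intro continuous_on_interior[of "- {1}"]) (auto simp: interior_open open_Compl)
    moreover have "isCont F (to_half_plane (cis t))"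
      using holomorphic_on_imp_continuous_on[OF holo] Re0
      by (intro continuous_on_interior[of "{w. - (1 / 2) < Re w}"])
        (auto simp: interior_open open_halfspace_Re_gt)
    moreover have "((\<lambda>r. complex_of_real r * cis t) \<longlongrightarrow> complex_of_real 1 * cis t) (at_left 1)"
      by (intro tendsto_intros)
    ultimately have "((\<lambda>r. F (to_half_plane (of_real r * cis t))) \<longlongrightarrow> F (to_half_plane (cis t))) (at_left 1)"
      by (intro isCont_tendsto_compose[of _ F] isCont_tendsto_compose[of _ to_half_plane]) simp_all
    with eq[OF Re0] show "\<exists>L. ((\<lambda>r. F (to_half_plane (of_real r * cis t))) \<longlongrightarrow> L) (at_left 1) \<and> cmod L = 1"
      by blast
  qed
  from 1 2 3 show ?thesis by (simp add: inner_function_def H_infinity_def)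
qed

section \<open>The atomic singular inner function at 1 and the sparse Blaschke product\<close>

definition exp_inner :: "complex \<Rightarrow> complex" where
  "exp_inner z = exp (- to_half_plane z)"

definition sparse_blaschke :: "complex \<Rightarrow> complex" where
  "sparse_blaschke z = half_plane_product (to_half_plane z)"

lemma inner_function_exp_inner: "inner_function exp_inner"
  unfolding exp_inner_def[abs_def]
  by (rule inner_function_from_half_plane) (auto intro!: holomorphic_intros)

lemma inner_function_sparse_blaschke: "inner_function sparse_blaschke"
  unfolding sparse_blaschke_def[abs_def]
  by (rule inner_function_from_half_plane)
    (auto simp: half_plane_product_holomorphic norm_half_plane_product_le_1 norm_half_plane_product_imaginary)

lemma exp_inner_nonconstant: "\<not> exp_inner constant_on ball 0 1"
proof
  assume "exp_inner constant_on ball 0 1"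
  then obtain c where c: "\<And>z. cmod z < 1 \<Longrightarrow> exp_inner z = c" by (auto simp: constant_on_def)
  have "exp (- 1 :: complex) = exp (- 2)"
    using c[OF from_half_plane(1)[of 1]] c[OF from_half_plane(1)[of 2]]
    by (simp add: exp_inner_def from_half_plane(2))
  then have "exp (- 1 :: real) = exp (- 2)" by (auto dest: arg_cong[where f=cmod])
  then show False by simp
qed

text \<open>In the half-plane variable the function vanishes at \<open>blaschke_zero 0\<close> but
  has modulus at least \<open>1 / 2\<close> at \<open>1 / 16\<close>.\<close>

lemma sparse_blaschke_nonconstant: "\<not> sparse_blaschke constant_on ball 0 1"
proof
  assume "sparse_blaschke constant_on ball 0 1"
  then obtain c where c: "\<And>z. cmod z < 1 \<Longrightarrow> sparse_blaschke z = c" by (auto simp: constant_on_def)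
  have "half_plane_product (1 / 16) = half_plane_product (of_real (blaschke_zero 0))"
    using c[OF from_half_plane(1)[of "1 / 16"]] c[OF from_half_plane(1)[of "of_real (blaschke_zero 0)"]] blaschke_zero_ge_1[of 0]
    by (simp add: sparse_blaschke_def from_half_plane(2))
  moreover have "1 / 2 \<le> cmod (half_plane_product (1 / 16))"
    by (rule half_plane_product_near_axis) auto
  ultimately show False by (simp add: half_plane_product_zero)
qed

text \<open>The modulus of \<open>to_half_plane\<close> maps a connected sublevel set onto an
  interval containing two consecutive zeros, hence the gap radius between them. For large
  \<open>n\<close> the product exceeds the level \<open>s\<close> on that semicircle.\<close>

lemma sparse_blaschke_not_one_component: "sparse_blaschke \<notin> one_component_inner"
proof
  assume "sparse_blaschke \<in> one_component_inner"
  with sparse_blaschke_nonconstant obtain s where s: "0 < s" "s < 1" and conn: "connected (Omega sparse_blaschke s)"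
    by (auto simp: one_component_inner_def)
  have "(\<lambda>n. 1 - 8 * (1 / 2) ^ n :: real) \<longlonglongrightarrow> 1 - 8 * 0"
    by (intro tendsto_intros LIMSEQ_power_zero) auto
  moreover have "s\<^sup>2 < 1 - 8 * 0" using s by (simp add: abs_square_less_1)
  ultimately have "\<forall>\<^sub>F n in sequentially. s\<^sup>2 < 1 - 8 * (1 / 2) ^ n \<and> 1 \<le> n"
    by (intro eventually_conj order_tendstoD(1) eventually_ge_at_top)
  then obtain n where n: "s\<^sup>2 < 1 - 8 * (1 / 2) ^ n" "1 \<le> n"
    by (auto simp: eventually_sequentially)
  have zero: "blaschke_zero k \<in> (\<lambda>z. cmod (to_half_plane z)) ` Omega sparse_blaschke s" for k
    using from_half_plane[of "of_real (blaschke_zero k)"] blaschke_zero_ge_1[of k] s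
    by (intro image_eqI[of _ _ "from_half_plane (of_real (blaschke_zero k))"])
      (auto simp: Omega_def sparse_blaschke_def half_plane_product_zero)
  have "connected ((\<lambda>z. cmod (to_half_plane z)) ` Omega sparse_blaschke s)"
    using conn unfolding to_half_plane_def
    by (intro connected_continuous_image continuous_intros) (auto simp: Omega_def)
  from connectedD_interval[OF this zero[of n] zero[of "Suc n"]]
  have "gap_radius n \<in> (\<lambda>z. cmod (to_half_plane z)) ` Omega sparse_blaschke s"
    using blaschke_zero_less_gap_radius[OF n(2)] gap_radius_less_blaschke_zero[of n] by simp
  then obtain z where z: "cmod z < 1" "cmod (sparse_blaschke z) < s" "cmod (to_half_plane z) = gap_radius n"
    by (auto simp: Omega_def)
  have "1 - 8 * (1 / 2) ^ n \<le> (cmod (sparse_blaschke z))\<^sup>2"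
    unfolding sparse_blaschke_def
    by (rule half_plane_product_gap) (use Re_to_half_plane_pos[OF z(1)] z(3) in auto)
  also have "\<dots> \<le> s\<^sup>2" using z(2) by (intro power_mono) auto
  finally show False using n(1) by simp
qed

lemma norm_exp_inner: "cmod (exp_inner z) = exp (- Re (to_half_plane z))"
  by (simp add: exp_inner_def)

text \<open>The modulus depends only on the real part in the half-plane, so this set is the image of
  the convex set \<open>1 / 16 < Re w\<close>, a horodisk at 1.\<close>

lemma connected_Omega_exp_inner: "connected (Omega exp_inner (exp (- (1 / 16))))"
proof -
  have "Omega exp_inner (exp (- (1 / 16))) = from_half_plane ` {w. 1 / 16 < Re w}"
  proof (intro equalityI subsetI)
    fix z assume z: "z \<in> Omega exp_inner (exp (- (1 / 16)))"
    then have "z \<noteq> 1" by (auto simp: Omega_def)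
    from from_half_plane_to_half_plane[OF this] z show "z \<in> from_half_plane ` {w. 1 / 16 < Re w}"
      by (intro image_eqI[of _ _ "to_half_plane z"]) (auto simp: Omega_def norm_exp_inner)
  qed (auto simp: Omega_def norm_exp_inner from_half_plane)
  moreover have "connected (from_half_plane ` {w. 1 / 16 < Re w})"
    unfolding from_half_plane_def
    by (intro connected_continuous_image continuous_intros convex_connected convex_halfspace_Re_gt)
      (auto simp: complex_eq_iff)
  ultimately show ?thesis by simp
qed

text \<open>\<open>connected_Omega\<close> with the horodisk as \<open>G\<close>. The level
  \<open>exp (- (1 / 16))\<close> matches \<open>half_plane_product_near_axis\<close>: off the
  horodisk the factors have moduli at least \<open>exp (- (1 / 16))\<close> and
  \<open>1 / 2\<close>.\<close>

lemma connected_Omega_product: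
  "connected (Omega (\<lambda>z. exp_inner z * sparse_blaschke z) (exp (- (1 / 16))))"
proof (rule connected_Omega[OF inner_function_mult[OF inner_function_exp_inner inner_function_sparse_blaschke]
      _ _ connected_Omega_exp_inner])
  show "Omega exp_inner (exp (- (1 / 16))) \<subseteq> Omega (\<lambda>z. exp_inner z * sparse_blaschke z) (exp (- (1 / 16)))"
  proof
    fix z assume z: "z \<in> Omega exp_inner (exp (- (1 / 16)))"
    then have "cmod (exp_inner z) * cmod (sparse_blaschke z) \<le> cmod (exp_inner z) * 1"
      using inner_function_le_1[OF inner_function_sparse_blaschke, of z] by (intro mult_left_mono) (auto simp: Omega_def)
    with z show "z \<in> Omega (\<lambda>z. exp_inner z * sparse_blaschke z) (exp (- (1 / 16)))"
      by (simp add: Omega_def norm_mult)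
  qed
  show "exp (- (1 / 16)) * (1 / 2) \<le> cmod (exp_inner z * sparse_blaschke z)"
    if z: "z \<in> Omega (\<lambda>z. exp_inner z * sparse_blaschke z) (exp (- (1 / 16))) - Omega exp_inner (exp (- (1 / 16)))" for z
  proof -
    have z1: "cmod z < 1" and low: "exp (- (1 / 16)) \<le> cmod (exp_inner z)" using z by (auto simp: Omega_def)
    have "Re (to_half_plane z) \<le> 1 / 16" using low by (simp add: norm_exp_inner)
    then have "1 / 2 \<le> cmod (sparse_blaschke z)"
      unfolding sparse_blaschke_def using Re_to_half_plane_pos[OF z1] by (intro half_plane_product_near_axis) auto
    with low show ?thesis unfolding norm_mult by (intro mult_mono) auto
  qed
qed auto

text \<open>The supremum is at most 1, and a value below 1 would make \<open>sparse_blaschke\<close>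
  one-component by \<open>factor_one_component\<close>.\<close>

lemma SUP_sparse_blaschke:
  "(SUP z\<in>level_set (\<lambda>z. exp_inner z * sparse_blaschke z) (exp (- (1 / 16))). cmod (sparse_blaschke z)) = 1"
proof -
  note inner = inner_function_exp_inner exp_inner_nonconstant inner_function_sparse_blaschke sparse_blaschke_nonconstant
  have \<eta>: "0 < exp (- (1 / 16 :: real))" "exp (- (1 / 16 :: real)) < 1" by auto
  from product_level_set_bounds(2)[OF inner \<eta> refl refl refl]
    factor_one_component[OF inner \<eta> refl refl refl connected_Omega_product] sparse_blaschke_not_one_component
  show ?thesis by (meson antisym_conv2)
qed

theorem proposition3p2:
  shows
    "(\<forall>(u :: complex \<Rightarrow> complex) (v :: complex \<Rightarrow> complex) (\<Theta> :: complex \<Rightarrow> complex) (\<eta> :: real) (\<sigma> :: real) (\<delta> :: real).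
        inner_function u \<and> \<not> u constant_on ball 0 1 \<and>
        inner_function v \<and> \<not> v constant_on ball 0 1 \<and>
        \<Theta> = (\<lambda>z. u z * v z) \<and>
        \<Theta> \<in> one_component_inner \<and> \<eta> \<in> {0<..<1} \<and> connected (Omega \<Theta> \<eta>) \<and>
        \<sigma> = (SUP z\<in>level_set \<Theta> \<eta>. cmod (v z)) \<and>
        \<delta> = (INF z\<in>level_set \<Theta> \<eta>. cmod (u z))
        \<longrightarrow> (\<sigma> \<in> {\<eta><..<1} \<longleftrightarrow> \<delta> \<in> {\<eta><..<1}) \<and>
            (\<sigma> = 1 \<longleftrightarrow> \<delta> = \<eta>) \<and>
            (\<sigma> \<in> {\<eta><..<1} \<longrightarrow> v \<in> one_component_inner)) \<and>
     (\<exists>(u :: complex \<Rightarrow> complex) (v :: complex \<Rightarrow> complex) (\<Theta> :: complex \<Rightarrow> complex) (\<eta> :: real).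
        inner_function u \<and> \<not> u constant_on ball 0 1 \<and>
        inner_function v \<and> \<not> v constant_on ball 0 1 \<and>
        \<Theta> = (\<lambda>z. u z * v z) \<and>
        \<Theta> \<in> one_component_inner \<and> \<eta> \<in> {0<..<1} \<and> connected (Omega \<Theta> \<eta>) \<and>
        (SUP z\<in>level_set \<Theta> \<eta>. cmod (v z)) = 1 \<and>
        v \<notin> one_component_inner)"
proof (intro conjI allI)
  fix u v \<Theta> :: "complex \<Rightarrow> complex" and \<eta> \<sigma> \<delta> :: real
  show "inner_function u \<and> \<not> u constant_on ball 0 1 \<and>
        inner_function v \<and> \<not> v constant_on ball 0 1 \<and>
        \<Theta> = (\<lambda>z. u z * v z) \<and>
        \<Theta> \<in> one_component_inner \<and> \<eta> \<in> {0<..<1} \<and> connected (Omega \<Theta> \<eta>) \<and>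
        \<sigma> = (SUP z\<in>level_set \<Theta> \<eta>. cmod (v z)) \<and>
        \<delta> = (INF z\<in>level_set \<Theta> \<eta>. cmod (u z))
        \<longrightarrow> (\<sigma> \<in> {\<eta><..<1} \<longleftrightarrow> \<delta> \<in> {\<eta><..<1}) \<and>
            (\<sigma> = 1 \<longleftrightarrow> \<delta> = \<eta>) \<and>
            (\<sigma> \<in> {\<eta><..<1} \<longrightarrow> v \<in> one_component_inner)" (is "?H \<longrightarrow> ?C")
  proof
    assume H: ?H
    then have "0 < \<eta>" "\<eta> < 1" by auto
    with H product_level_set_SUP_INF_iff[of u v \<eta> \<Theta> \<sigma> \<delta>] factor_one_component[of u v \<eta> \<Theta> \<sigma> \<delta>]
    show ?C by (metis greaterThanLessThan_iff)
  qed
next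
  have "(\<lambda>z. exp_inner z * sparse_blaschke z) \<in> one_component_inner"
    using connected_Omega_product inner_function_mult[OF inner_function_exp_inner inner_function_sparse_blaschke]
    by (auto simp: one_component_inner_def intro!: bexI[of _ "exp (- (1 / 16))"])
  then show "\<exists>(u :: complex \<Rightarrow> complex) (v :: complex \<Rightarrow> complex) (\<Theta> :: complex \<Rightarrow> complex) (\<eta> :: real).
        inner_function u \<and> \<not> u constant_on ball 0 1 \<and>
        inner_function v \<and> \<not> v constant_on ball 0 1 \<and>
        \<Theta> = (\<lambda>z. u z * v z) \<and>
        \<Theta> \<in> one_component_inner \<and> \<eta> \<in> {0<..<1} \<and> connected (Omega \<Theta> \<eta>) \<and>
        (SUP z\<in>level_set \<Theta> \<eta>. cmod (v z)) = 1 \<and>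
        v \<notin> one_component_inner"
    using inner_function_exp_inner exp_inner_nonconstant inner_function_sparse_blaschke sparse_blaschke_nonconstant
      connected_Omega_product SUP_sparse_blaschke sparse_blaschke_not_one_component
    by (intro exI[of _ exp_inner] exI[of _ sparse_blaschke] exI[of _ "\<lambda>z. exp_inner z * sparse_blaschke z"]
        exI[of _ "exp (- (1 / 16))"]) auto
qed

end
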